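(* Let $0<H<1$, fix a time horizon $T>0$, and for $\epsilon>0$ let $X^\epsilon$ be the kinetic fractional Brownian motion (defined in the context), observed at sampling rate $\delta=\epsilon^\alpha$ with $T=N\delta$, $N\in\mathbb{N}$. Let $\hat{\sigma}^2_{\delta,\epsilon}=\frac1N(\Delta_\delta X^\epsilon)^{T}P^{-1}\Delta_\delta X^\epsilon$ be the estimator defined in the context, and let $\overline{\sigma}=\sigma_1\sigma_2$. If $0<\alpha<\min\left\{1,\frac{H}{1-H}\right\}$, then $$\hat{\sigma}_{\delta,\epsilon}^2\longrightarrow\overline{\sigma}^2\quad\text{in }L^2\text{ as }\epsilon\to0^+$$ (with $\epsilon$ ranging over values for which $N=T/\delta$ is a positive integer).
   Context: Fractional Brownian motion: $(B^H_t)_{t\in\mathbb{R}}$ is a (two-sided) fractional Brownian motion of Hurst index $H\in(0,1)$, i.e. a continuous centred Gaussian process with $\mathbb{E}[B^H_tB^H_s]=\frac12(|t|^{2H}+|s|^{2H}-|t-s|^{2H})$. Kinetic fractional Brownian motion: for fixed $\epsilon>0$ and constants $\sigma_1,\sigma_2,x_0\in\mathbb{R}$, $(X^\epsilon_t)_{t\ge0}$ is the solution of the system $$dX^\epsilon_t=\sigma_1\epsilon^{H-1}Y^\epsilon_t\,dt,\quad X^\epsilon_0=x_0,$$ $$dY^\epsilon_t=-\frac1\epsilon Y^\epsilon_t\,dt+\frac{\sigma_2}{\epsilon^H}\,dB^H_t,\quad Y^\epsilon_0=\epsilon^{-H}\sigma_2\int_{-\infty}^0 e^{s/\epsilon}\,dB^H_s,$$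 so that $Y^\epsilon$ is the stationary fractional Ornstein-Uhlenbeck process $Y^\epsilon_t=\epsilon^{-H}\sigma_2\int_{-\infty}^t e^{-(t-s)/\epsilon}dB^H_s$. Here $\epsilon$ is called the scale separation parameter. Increments and estimator: for $\delta=T/N$ and a process $Z$, $\Delta_\delta Z=(Z_{(i+1)\delta}-Z_{i\delta})_{i=0}^{N-1}\in\mathbb{R}^N$ (column vector). $P$ is the $N\times N$ covariance matrix of $\Delta_\delta B^H$, with entries $$P_{ij}=\tfrac12\delta^{2H}\left[(|i-j|+1)^{2H}+\big||i-j|-1\big|^{2H}-2|i-j|^{2H}\right].$$ The estimator is $\hat\sigma^2_{\delta,\epsilon}=\frac1N(\Delta_\delta X^\epsilon)^{T}P^{-1}\Delta_\delta X^\epsilon$, where the superscript $T$ on a vector denotes transpose. Convergence in $L^2$ refers to $L^2(\Omega)$ of the underlying probability space. *)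

theory Defs
  imports
    "HOL-Probability.Probability"
    "Jordan_Normal_Form.Gauss_Jordan_Elimination"
begin

section \<open>Gaussian processes and fractional Brownian motion\<close>

text \<open>Constants count as (degenerate) Gaussian variables.\<close>

definition gaussian_rv :: "'a measure \<Rightarrow> ('a \<Rightarrow> real) \<Rightarrow> bool" where
  "gaussian_rv M Z \<longleftrightarrow> Z \<in> borel_measurable M \<and>
     ((\<exists>m s. s > 0 \<and> distributed M lborel Z (\<lambda>x. ennreal (normal_density m s x))) \<or>
      (\<exists>m. AE \<omega> in M. Z \<omega> = m))"

definition gaussian_process :: "'a measure \<Rightarrow> ('i \<Rightarrow> 'a \<Rightarrow> real) \<Rightarrow> bool" where
  "gaussian_process M Z \<longleftrightarrow>
     (\<forall>J (c :: 'i \<Rightarrow> real). finite J \<longrightarrow> gaussian_rv M (\<lambda>\<omega>. \<Sum>t\<in>J. c t * Z t \<omega>))"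

definition fractional_brownian_motion ::
    "'a measure \<Rightarrow> real \<Rightarrow> (real \<Rightarrow> 'a \<Rightarrow> real) \<Rightarrow> bool" where
  "fractional_brownian_motion M H B \<longleftrightarrow>
     gaussian_process M B \<and>
     (\<forall>t. (\<integral>\<omega>. B t \<omega> \<partial>M) = 0) \<and>
     (\<forall>s t. (\<integral>\<omega>. B t \<omega> * B s \<omega> \<partial>M) =
        (\<bar>t\<bar> powr (2 * H) + \<bar>s\<bar> powr (2 * H) - \<bar>t - s\<bar> powr (2 * H)) / 2) \<and>
     (AE \<omega> in M. continuous_on UNIV (\<lambda>t. B t \<omega>))"

section \<open>Pathwise integrals\<close>

text \<open>The Riemann--Stieltjes integral of \<open>f\<close> against \<open>g\<close> over \<open>[a, b]\<close>. It exists for smooth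
  \<open>f\<close> and continuous \<open>g\<close>, which need not have bounded variation.\<close>

definition has_rs_integral ::
    "(real \<Rightarrow> real) \<Rightarrow> (real \<Rightarrow> real) \<Rightarrow> real \<Rightarrow> real \<Rightarrow> real \<Rightarrow> bool" where
  "has_rs_integral f g a b I \<longleftrightarrow>
     (\<forall>e>0. \<exists>d>0. \<forall>p. p tagged_division_of {a..b} \<and> (\<lambda>x. ball x d) fine p \<longrightarrow>
        \<bar>(\<Sum>(x, K)\<in>p. f x * (g (Sup K) - g (Inf K))) - I\<bar> < e)"

definition has_rs_integral_from_minf ::
    "(real \<Rightarrow> real) \<Rightarrow> (real \<Rightarrow> real) \<Rightarrow> real \<Rightarrow> real \<Rightarrow> bool" where
  "has_rs_integral_from_minf f g b I \<longleftrightarrow>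
     (\<exists>J. (\<forall>a<b. has_rs_integral f g a b (J a)) \<and> (J \<longlongrightarrow> I) at_bot)"

section \<open>Kinetic fractional Brownian motion\<close>

text \<open>The noise is additive, so the system is read pathwise in integrated form, the integral of
  \<open>dB\<close> over \<open>[0, t]\<close> being \<open>B t - B 0\<close>. The initial value of \<open>Y\<close> is the pathwise improper
  Riemann--Stieltjes integral, which agrees almost surely with the Wiener integral.\<close>

definition kinetic_fbm ::
    "'a measure \<Rightarrow> real \<Rightarrow> real \<Rightarrow> real \<Rightarrow> real \<Rightarrow> real \<Rightarrow> (real \<Rightarrow> 'a \<Rightarrow> real) \<Rightarrow>
     (real \<Rightarrow> 'a \<Rightarrow> real) \<Rightarrow> (real \<Rightarrow> 'a \<Rightarrow> real) \<Rightarrow> bool" where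
  "kinetic_fbm M H \<sigma>1 \<sigma>2 x0 \<epsilon> B X Y \<longleftrightarrow>
     (\<forall>t\<ge>0. X t \<in> borel_measurable M \<and> Y t \<in> borel_measurable M) \<and>
     (AE \<omega> in M.
        continuous_on {0..} (\<lambda>t. Y t \<omega>) \<and>
        (\<exists>I. has_rs_integral_from_minf (\<lambda>s. exp (s / \<epsilon>)) (\<lambda>s. B s \<omega>) 0 I \<and>
             Y 0 \<omega> = \<epsilon> powr (- H) * \<sigma>2 * I) \<and>
        (\<forall>t\<ge>0. Y t \<omega> = Y 0 \<omega> - 1 / \<epsilon> * integral {0..t} (\<lambda>s. Y s \<omega>)
                          + \<sigma>2 / \<epsilon> powr H * (B t \<omega> - B 0 \<omega>)) \<and>
        (\<forall>t\<ge>0. X t \<omega> = x0 + integral {0..t} (\<lambda>s. \<sigma>1 * \<epsilon> powr (H - 1) * Y s \<omega>)))"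

section \<open>The estimator\<close>

definition increments :: "(real \<Rightarrow> 'a \<Rightarrow> real) \<Rightarrow> real \<Rightarrow> nat \<Rightarrow> 'a \<Rightarrow> real Matrix.vec" where
  "increments Z \<delta> N \<omega> =
     Matrix.vec N (\<lambda>i. Z ((real i + 1) * \<delta>) \<omega> - Z (real i * \<delta>) \<omega>)"

definition fbm_cov_mat :: "real \<Rightarrow> real \<Rightarrow> nat \<Rightarrow> real Matrix.mat" where
  "fbm_cov_mat H \<delta> N = Matrix.mat N N (\<lambda>(i, j). 1 / 2 * \<delta> powr (2 * H) *
     ((\<bar>real i - real j\<bar> + 1) powr (2 * H) + \<bar>\<bar>real i - real j\<bar> - 1\<bar> powr (2 * H)
        - 2 * \<bar>real i - real j\<bar> powr (2 * H)))"

text \<open>The covariance matrix is nonsingular for \<open>0 < H < 1\<close> and \<open>\<delta> > 0\<close>, so \<open>mat_inverse\<close> does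
  not return \<open>None\<close> in that range.\<close>

definition sigma2_estimator ::
    "real \<Rightarrow> real \<Rightarrow> nat \<Rightarrow> (real \<Rightarrow> 'a \<Rightarrow> real) \<Rightarrow> 'a \<Rightarrow> real" where
  "sigma2_estimator H \<delta> N X \<omega> = 1 / real N *
     scalar_prod (increments X \<delta> N \<omega>)
       (the (mat_inverse (fbm_cov_mat H \<delta> N)) *\<^sub>v increments X \<delta> N \<omega>)"

section \<open>Convergence in mean square\<close>

definition square_integrable :: "'a measure \<Rightarrow> ('a \<Rightarrow> real) \<Rightarrow> bool" where
  "square_integrable M Z \<longleftrightarrow> Z \<in> borel_measurable M \<and> integrable M (\<lambda>\<omega>. (Z \<omega>)\<^sup>2)"

definition tendsto_L2_within ::
    "'a measure \<Rightarrow> (real \<Rightarrow> 'a \<Rightarrow> real) \<Rightarrow> ('a \<Rightarrow> real) \<Rightarrow> real \<Rightarrow> real set \<Rightarrow> bool" where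
  "tendsto_L2_within M Z L a S \<longleftrightarrow>
     (\<forall>x\<in>S. square_integrable M (Z x)) \<and> square_integrable M L \<and>
     ((\<lambda>x. \<integral>\<omega>. (Z x \<omega> - L \<omega>)\<^sup>2 \<partial>M) \<longlongrightarrow> 0) (at a within S)"

text \<open>The scale parameters for which the horizon is a positive integer multiple of the sampling
  step \<open>\<epsilon> powr \<alpha>\<close>; for \<open>T, \<alpha> > 0\<close> this set accumulates at \<open>0\<close>.\<close>

definition admissible_scales :: "real \<Rightarrow> real \<Rightarrow> real set" where
  "admissible_scales T \<alpha> = {\<epsilon>. \<epsilon> > 0 \<and> (\<exists>n::nat. n > 0 \<and> T = real n * \<epsilon> powr \<alpha>)}"

end

theory Submission
  imports Defs "Jordan_Normal_Form.Determinant"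
begin

text \<open>
  Integrating the velocity equation gives, outside a null set,
  \<open>X t - X u = \<sigma>1 * \<sigma>2 * (B t - B u) - \<sigma>1 * \<epsilon> powr H * (Y t - Y u)\<close> (\<open>position_increment\<close>).
  With \<open>s = \<sigma>1 * \<sigma>2\<close>, the observed increments are therefore \<open>s * b + r\<close>, where \<open>b\<close> is fractional
  Gaussian noise with covariance matrix \<open>P\<close> and \<open>r\<close> is of order \<open>\<epsilon> powr H\<close>, because the moments of
  the stationary process \<open>Y\<close> do not depend on \<open>\<epsilon>\<close>. The estimator is the quadratic form of the
  inverse of \<open>P\<close>, divided by \<open>n\<close>, and so it splits as \<open>s^2 * A + 2 * s * C + D\<close> with a pure noise
  term \<open>A\<close>, a cross term \<open>C\<close> and a pure perturbation term \<open>D\<close>.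

  The noise term is \<open>1 / n\<close> times a chi-square variable with \<open>n\<close> degrees of freedom, so it has mean
  1 and variance \<open>2 / n\<close> whatever \<open>P\<close> is (\<open>normalised_quadratic_form\<close>). If \<open>lam\<close> bounds the
  eigenvalues of \<open>P\<close> from below, then \<open>D\<close> is at most \<open>|r|^2 / (n * lam)\<close>, and positivity of the
  quadratic form bounds \<open>C\<close> by \<open>A\<close> and \<open>D\<close>. The mean square error is thus governed by \<open>1 / n\<close> and by
  \<open>\<kappa> = const * \<epsilon> powr (2 * H) / lam\<close> (\<open>estimator_mean_square_error\<close>).

  Two estimates remain. For \<open>lam\<close>, the spectral density of fractional Gaussian noise behaves like
  \<open>x powr (1 - 2 * H)\<close> at low frequencies. For \<open>H \<ge> 1/2\<close> it is bounded below; for \<open>H < 1/2\<close> it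
  vanishes at 0, but a trigonometric polynomial with \<open>n\<close> terms cannot concentrate its mass on
  frequencies much below \<open>1 / n\<close>. Hence \<open>lam\<close> can be taken as a constant times
  \<open>\<delta> powr (2 * H) * n powr (- max 0 (1 - 2 * H))\<close> (\<open>fgn_cov_coercive\<close>). For the fourth moments
  of \<open>Y\<close>, both \<open>Y 0\<close> and the noise accumulated by \<open>Y t\<close> after time 0 are pathwise limits of
  Riemann--Stieltjes sums of \<open>B\<close>; these sums are Gaussian with uniformly bounded variance, and
  Fatou's lemma carries the bound to the limit without identifying its law
  (\<open>stationary_fourth_moment\<close>).

  With \<open>\<delta> = \<epsilon> powr \<alpha>\<close> and \<open>n = T / \<delta>\<close>, \<open>\<kappa>\<close> is a constant times a power of \<open>\<epsilon>\<close> with exponent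
  \<open>2 * H * (1 - \<alpha>)\<close> if \<open>H \<ge> 1/2\<close> and \<open>2 * H - \<alpha>\<close> otherwise. Both are positive under
  the assumption on \<open>\<alpha>\<close>, since \<open>H / (1 - H) \<le> 2 * H\<close> for \<open>H \<le> 1/2\<close>.
\<close>

section \<open>Random variables with a finite fourth moment\<close>

definition L4 :: "'a measure \<Rightarrow> ('a \<Rightarrow> real) \<Rightarrow> bool" where
  "L4 M Z \<longleftrightarrow> Z \<in> borel_measurable M \<and> integrable M (\<lambda>\<omega>. Z \<omega> ^ 4)"

lemma prod_four_le: "\<bar>a * b * c * d\<bar> \<le> a^4 + b^4 + c^4 + (d::real)^4"
proof -
  have two: "2 * \<bar>x * y\<bar> \<le> x\<^sup>2 + y\<^sup>2" for x y :: real
    using sum_squares_bound[of "\<bar>x\<bar>" "\<bar>y\<bar>"] by (simp add: abs_mult)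
  have "2 * \<bar>(a * b) * (c * d)\<bar> \<le> (a * b)\<^sup>2 + (c * d)\<^sup>2" by (rule two)
  moreover have "2 * (a * b)\<^sup>2 \<le> a^4 + b^4"
    using two[of "a\<^sup>2" "b\<^sup>2"] by (simp add: power_mult_distrib flip: power_mult)
  moreover have "2 * (c * d)\<^sup>2 \<le> c^4 + d^4"
    using two[of "c\<^sup>2" "d\<^sup>2"] by (simp add: power_mult_distrib flip: power_mult)
  moreover have "0 \<le> a^4" "0 \<le> b^4" "0 \<le> c^4" "0 \<le> d^4" by auto
  ultimately show ?thesis by (simp add: mult.assoc)
qed

lemma power4_add_le: "(a + b) ^ 4 \<le> 8 * (a ^ 4 + (b::real) ^ 4)"
proof -
  have sq: "(x + y)\<^sup>2 \<le> 2 * (x\<^sup>2 + y\<^sup>2)" for x y :: real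
    using sum_squares_bound[of x y] by (simp add: power2_sum)
  have "(a + b) ^ 4 = ((a + b)\<^sup>2)\<^sup>2" by simp
  also have "\<dots> \<le> (2 * (a\<^sup>2 + b\<^sup>2))\<^sup>2" by (intro power_mono sq) auto
  also have "\<dots> = 4 * (a\<^sup>2 + b\<^sup>2)\<^sup>2" unfolding power_mult_distrib by simp
  also have "\<dots> \<le> 4 * (2 * ((a\<^sup>2)\<^sup>2 + (b\<^sup>2)\<^sup>2))" by (intro mult_left_mono sq) auto
  finally show ?thesis by simp
qed

lemma L4_measurable: "L4 M Z \<Longrightarrow> Z \<in> borel_measurable M"
  by (simp add: L4_def)

lemma L4_prod4:
  assumes "L4 M a" "L4 M b" "L4 M c" "L4 M d"
  shows "integrable M (\<lambda>\<omega>. a \<omega> * b \<omega> * c \<omega> * d \<omega>)"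
proof (rule Bochner_Integration.integrable_bound)
  show "integrable M (\<lambda>\<omega>. a \<omega> ^ 4 + b \<omega> ^ 4 + c \<omega> ^ 4 + d \<omega> ^ 4)"
    using assms by (auto simp: L4_def)
  show "(\<lambda>\<omega>. a \<omega> * b \<omega> * c \<omega> * d \<omega>) \<in> borel_measurable M"
    using assms[THEN L4_measurable] by measurable
  show "AE \<omega> in M. norm (a \<omega> * b \<omega> * c \<omega> * d \<omega>) \<le> norm (a \<omega> ^ 4 + b \<omega> ^ 4 + c \<omega> ^ 4 + d \<omega> ^ 4)"
  proof (rule AE_I2)
    fix \<omega>
    show "norm (a \<omega> * b \<omega> * c \<omega> * d \<omega>) \<le> norm (a \<omega> ^ 4 + b \<omega> ^ 4 + c \<omega> ^ 4 + d \<omega> ^ 4)"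
      unfolding real_norm_def by (rule order_trans[OF prod_four_le abs_ge_self])
  qed
qed

lemma L4_add:
  assumes "L4 M a" "L4 M b" shows "L4 M (\<lambda>\<omega>. a \<omega> + b \<omega>)"
proof -
  have m [measurable]: "a \<in> borel_measurable M" "b \<in> borel_measurable M"
    using assms by (auto simp: L4_def)
  have "integrable M (\<lambda>\<omega>. (a \<omega> + b \<omega>) ^ 4)"
  proof (rule Bochner_Integration.integrable_bound)
    show "integrable M (\<lambda>\<omega>. 8 * (a \<omega> ^ 4 + b \<omega> ^ 4))"
      using assms by (auto simp: L4_def)
    show "AE \<omega> in M. norm ((a \<omega> + b \<omega>) ^ 4) \<le> norm (8 * (a \<omega> ^ 4 + b \<omega> ^ 4))"
      using power4_add_le by (intro AE_I2) (simp add: abs_of_nonneg)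
  qed measurable
  then show ?thesis by (simp add: L4_def)
qed

lemma L4_scale: "L4 M a \<Longrightarrow> L4 M (\<lambda>\<omega>. r * a \<omega>)"
  by (auto simp: L4_def power_mult_distrib)

lemma (in prob_space) L4_const: "L4 M (\<lambda>_. r)"
  by (simp add: L4_def)

lemma (in prob_space) L4_prod2:
  "L4 M a \<Longrightarrow> L4 M b \<Longrightarrow> integrable M (\<lambda>\<omega>. a \<omega> * b \<omega>)"
  using L4_prod4[OF _ _ L4_const[of 1] L4_const[of 1], of a b] by simp

section \<open>Moments of centred Gaussian variables\<close>

text \<open>Polarisation: the signed sum kills every monomial that is even in one of \<open>b\<close>, \<open>c\<close>, \<open>d\<close>, so only
\<open>a * b * c * d\<close> survives, with coefficient \<open>8 * 4!\<close>. It recovers a mixed fourth moment from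
fourth moments of single variables.\<close>

lemma polarisation4:
  "(\<Sum>s\<in>{-1, 1}. \<Sum>t\<in>{-1, 1}. \<Sum>u\<in>{-1, 1}. s * t * u * (a + s * b + t * c + u * d) ^ 4)
    = 192 * (a * b * c * (d::real))"
proof -
  have u: "(\<Sum>u\<in>{-1, 1}. s * t * u * (x + u * d) ^ 4) = s * t * (8 * x ^ 3 * d + 8 * x * d ^ 3)"
    for s t x :: real
    by (simp add: eval_nat_numeral algebra_simps)
  have t: "(\<Sum>t\<in>{-1, 1}. s * t * (8 * (x + t * c) ^ 3 * d + 8 * (x + t * c) * d ^ 3))
      = s * (8 * d * (6 * x\<^sup>2 * c + 2 * c ^ 3) + 16 * c * d ^ 3)" for s x :: real
    by (simp add: eval_nat_numeral algebra_simps)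
  have s: "(\<Sum>s\<in>{-1, 1}. s * (8 * d * (6 * (a + s * b)\<^sup>2 * c + 2 * c ^ 3) + 16 * c * d ^ 3))
      = 192 * (a * b * c * d)"
    by (simp add: eval_nat_numeral algebra_simps)
  show ?thesis unfolding u t s ..
qed

text \<open>The same signed sum applied to \<open>3 * v\<^sup>2\<close>, where \<open>v\<close> is the variance of
\<open>a + s * b + t * c + u * d\<close> expressed through the pairwise covariances, with \<open>q\<close> the sum of the
four variances.\<close>

lemma polarisation_sq:
  "(\<Sum>s\<in>{-1, 1}. \<Sum>t\<in>{-1, 1}. \<Sum>u\<in>{-1, 1}. s * t * u * (3 * (q + 2 * s * ab + 2 * t * ac + 2 * u * ad
      + 2 * s * t * bc + 2 * s * u * bd + 2 * t * u * cd)\<^sup>2))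
    = 192 * (ab * cd + ac * bd + ad * (bc::real))"
proof -
  have u: "(\<Sum>u\<in>{-1, 1}. s * t * u * (3 * (q + 2 * s * ab + 2 * t * ac + 2 * u * ad
      + 2 * s * t * bc + 2 * s * u * bd + 2 * t * u * cd)\<^sup>2))
     = s * t * (24 * (q + 2 * s * ab + 2 * t * ac + 2 * s * t * bc) * (ad + s * bd + t * cd))" for s t :: real
    by (simp add: eval_nat_numeral algebra_simps)
  have t: "(\<Sum>t\<in>{-1, 1}. s * t * (24 * (q + 2 * s * ab + 2 * t * ac + 2 * s * t * bc) * (ad + s * bd + t * cd)))
      = s * (48 * (q + 2 * s * ab) * cd + 96 * (ac + s * bc) * (ad + s * bd))" for s :: real
    by (simp add: eval_nat_numeral algebra_simps)
  have s: "(\<Sum>s\<in>{-1, 1}. s * (48 * (q + 2 * s * ab) * cd + 96 * (ac + s * bc) * (ad + s * bd)))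
      = 192 * (ab * cd + ac * bd + ad * bc)"
    by (simp add: eval_nat_numeral algebra_simps)
  show ?thesis unfolding u t s ..
qed
lemma (in prob_space) gaussian_fourth_moment:
  assumes g: "gaussian_rv M Z" and mean: "(\<integral>\<omega>. Z \<omega> \<partial>M) = 0"
  shows "L4 M Z" and "(\<integral>\<omega>. Z \<omega> ^ 4 \<partial>M) = 3 * (\<integral>\<omega>. (Z \<omega>)\<^sup>2 \<partial>M)\<^sup>2"
proof -
  have meas [measurable]: "Z \<in> borel_measurable M" using g by (simp add: gaussian_rv_def)
  have "integrable M (\<lambda>\<omega>. Z \<omega> ^ 4) \<and> (\<integral>\<omega>. Z \<omega> ^ 4 \<partial>M) = 3 * (\<integral>\<omega>. (Z \<omega>)\<^sup>2 \<partial>M)\<^sup>2"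
    using g unfolding gaussian_rv_def
  proof (elim conjE disjE exE)
    fix m s :: real
    assume s: "s > 0" and d: "distributed M lborel Z (\<lambda>x. ennreal (normal_density m s x))"
    have "m = (\<integral>\<omega>. Z \<omega> \<partial>M)"
      using distributed_integral[OF d, of "\<lambda>x. x"] integral_normal_moment_nz_1[OF s, of m]
      by simp
    then have m: "m = 0" using mean by simp
    have i4: "has_bochner_integral lborel (\<lambda>x. normal_density m s x * x ^ 4) (3 * s ^ 4)"
      using normal_moment_even[OF s, of m 2] s unfolding m
      by (simp add: field_simps fact_numeral flip: power_mult)
    have i2: "has_bochner_integral lborel (\<lambda>x. normal_density m s x * x\<^sup>2) (s\<^sup>2)"
      using normal_moment_even[OF s, of m 1] s unfolding m
      by (simp add: fact_numeral)
    have "integrable M (\<lambda>\<omega>. Z \<omega> ^ 4)"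
      using distributed_integrable[OF d, of "\<lambda>x. x ^ 4"] i4
      by (simp add: has_bochner_integral_iff)
    moreover have "(\<integral>\<omega>. Z \<omega> ^ 4 \<partial>M) = 3 * s ^ 4"
      using distributed_integral[OF d, of "\<lambda>x. x ^ 4"] i4
      by (simp add: has_bochner_integral_iff)
    moreover have "(\<integral>\<omega>. (Z \<omega>)\<^sup>2 \<partial>M) = s\<^sup>2"
      using distributed_integral[OF d, of "\<lambda>x. x\<^sup>2"] i2
      by (simp add: has_bochner_integral_iff)
    ultimately show ?thesis by simp
  next
    fix m assume c: "AE \<omega> in M. Z \<omega> = m"
    have "(\<integral>\<omega>. Z \<omega> \<partial>M) = (\<integral>\<omega>. m \<partial>M)" using c by (intro integral_cong_AE) auto
    then have m: "m = 0" using mean by (simp add: prob_space)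
    have "integrable M (\<lambda>\<omega>. Z \<omega> ^ 4) = integrable M (\<lambda>\<omega>. 0 :: real)"
      using c by (intro integrable_cong_AE) (auto simp: m)
    moreover have "(\<integral>\<omega>. Z \<omega> ^ 4 \<partial>M) = (\<integral>\<omega>. 0 \<partial>M)" "(\<integral>\<omega>. (Z \<omega>)\<^sup>2 \<partial>M) = (\<integral>\<omega>. 0 \<partial>M)"
      using c by (intro integral_cong_AE; auto simp: m)+
    ultimately show ?thesis by simp
  qed
  then show "L4 M Z" "(\<integral>\<omega>. Z \<omega> ^ 4 \<partial>M) = 3 * (\<integral>\<omega>. (Z \<omega>)\<^sup>2 \<partial>M)\<^sup>2"
    by (auto simp: L4_def)
qed

text \<open>Only finite linear combinations of a Gaussian process are known to be Gaussian, so moment formulas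
are proved for this span; increments and Riemann--Stieltjes sums lie in it.\<close>

definition lin_span :: "('i \<Rightarrow> 'a \<Rightarrow> real) \<Rightarrow> ('a \<Rightarrow> real) set" where
  "lin_span B = {Z. \<exists>J c. finite J \<and> Z = (\<lambda>\<omega>. \<Sum>t\<in>J. c t * B t \<omega>)}"

lemma lin_span_base: "B t \<in> lin_span B"
  unfolding lin_span_def by (intro CollectI exI[of _ "{t}"] exI[of _ "\<lambda>_. 1"]) auto

lemma lin_span_scale: "Z \<in> lin_span B \<Longrightarrow> (\<lambda>\<omega>. r * Z \<omega>) \<in> lin_span B"
proof -
  assume "Z \<in> lin_span B"
  then obtain J c where "finite J" "Z = (\<lambda>\<omega>. \<Sum>t\<in>J. c t * B t \<omega>)" by (auto simp: lin_span_def)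
  then show ?thesis
    unfolding lin_span_def by (intro CollectI exI[of _ J] exI[of _ "\<lambda>t. r * c t"])
      (auto simp: sum_distrib_left mult.assoc)
qed

lemma lin_span_add:
  assumes "Z \<in> lin_span B" "W \<in> lin_span B" shows "(\<lambda>\<omega>. Z \<omega> + W \<omega>) \<in> lin_span B"
proof -
  obtain J c where J: "finite J" "Z = (\<lambda>\<omega>. \<Sum>t\<in>J. c t * B t \<omega>)"
    using assms by (auto simp: lin_span_def)
  obtain L e where L: "finite L" "W = (\<lambda>\<omega>. \<Sum>t\<in>L. e t * B t \<omega>)"
    using assms by (auto simp: lin_span_def)
  let ?c = "\<lambda>t. (if t \<in> J then c t else 0) + (if t \<in> L then e t else 0)"
  have 1: "(\<Sum>t\<in>J. c t * B t \<omega>) = (\<Sum>t\<in>J\<union>L. (if t \<in> J then c t else 0) * B t \<omega>)" for \<omega>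
    using J L by (intro sum.mono_neutral_cong_left) auto
  have 2: "(\<Sum>t\<in>L. e t * B t \<omega>) = (\<Sum>t\<in>J\<union>L. (if t \<in> L then e t else 0) * B t \<omega>)" for \<omega>
    using J L by (intro sum.mono_neutral_cong_left) auto
  have "(\<lambda>\<omega>. Z \<omega> + W \<omega>) = (\<lambda>\<omega>. \<Sum>t\<in>J\<union>L. ?c t * B t \<omega>)"
    unfolding J(2) L(2) 1 2 by (simp add: sum.distrib distrib_right)
  then show ?thesis
    using J L unfolding lin_span_def by (intro CollectI exI[of _ "J \<union> L"] exI[of _ ?c]) auto
qed

lemma lin_span_zero: "(\<lambda>_. 0) \<in> lin_span B"
  unfolding lin_span_def by (intro CollectI exI[of _ "{}"]) auto

lemma lin_span_diff:
  "Z \<in> lin_span B \<Longrightarrow> W \<in> lin_span B \<Longrightarrow> (\<lambda>\<omega>. Z \<omega> - W \<omega>) \<in> lin_span B"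
  using lin_span_add[of Z B "\<lambda>\<omega>. (-1) * W \<omega>"] lin_span_scale[of W B "-1"] by simp

lemma lin_span_sum:
  "(\<And>k. k \<in> K \<Longrightarrow> Z k \<in> lin_span B) \<Longrightarrow> (\<lambda>\<omega>. \<Sum>k\<in>K. Z k \<omega>) \<in> lin_span B"
  by (induction K rule: infinite_finite_induct) (auto intro!: lin_span_zero lin_span_add)

locale centred_gaussian_process = prob_space M for M :: "'a measure" +
  fixes B :: "'i \<Rightarrow> 'a \<Rightarrow> real"
  assumes gaussian: "gaussian_process M B"
    and centred: "\<And>t. (\<integral>\<omega>. B t \<omega> \<partial>M) = 0"
begin

lemma base_L4: "L4 M (B t)"
proof -
  have "gaussian_rv M (\<lambda>\<omega>. \<Sum>t\<in>{t}. 1 * B t \<omega>)"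
    using gaussian unfolding gaussian_process_def by (elim allE[of _ "{t}"] allE[of _ "\<lambda>_. 1"]) simp
  then show ?thesis using gaussian_fourth_moment(1) centred by simp
qed

lemma
  assumes "Z \<in> lin_span B"
  shows span_L4: "L4 M Z"
    and span_fourth_moment: "(\<integral>\<omega>. Z \<omega> ^ 4 \<partial>M) = 3 * (\<integral>\<omega>. (Z \<omega>)\<^sup>2 \<partial>M)\<^sup>2"
proof -
  obtain J c where J: "finite J" "Z = (\<lambda>\<omega>. \<Sum>t\<in>J. c t * B t \<omega>)"
    using assms by (auto simp: lin_span_def)
  have g: "gaussian_rv M Z" using gaussian J unfolding gaussian_process_def by auto
  have "integrable M (B t)" for t using L4_prod2[OF base_L4 L4_const[of 1]] by simp
  then have "(\<integral>\<omega>. Z \<omega> \<partial>M) = 0" unfolding J(2) by (simp add: centred)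
  then show "L4 M Z" "(\<integral>\<omega>. Z \<omega> ^ 4 \<partial>M) = 3 * (\<integral>\<omega>. (Z \<omega>)\<^sup>2 \<partial>M)\<^sup>2"
    using gaussian_fourth_moment[OF g] by auto
qed

text \<open>Isserlis' formula. Every signed combination \<open>Z\<close> of the four variables is centred Gaussian, so
its fourth moment is three times its squared variance; polarising both sides gives the claim.\<close>

lemma isserlis:
  assumes "a \<in> lin_span B" "b \<in> lin_span B" "c \<in> lin_span B" "d \<in> lin_span B"
  shows "(\<integral>\<omega>. a \<omega> * b \<omega> * c \<omega> * d \<omega> \<partial>M) =
    (\<integral>\<omega>. a \<omega> * b \<omega> \<partial>M) * (\<integral>\<omega>. c \<omega> * d \<omega> \<partial>M) +
    (\<integral>\<omega>. a \<omega> * c \<omega> \<partial>M) * (\<integral>\<omega>. b \<omega> * d \<omega> \<partial>M) +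
    (\<integral>\<omega>. a \<omega> * d \<omega> \<partial>M) * (\<integral>\<omega>. b \<omega> * c \<omega> \<partial>M)"
proof -
  let ?E = "\<lambda>f. integral\<^sup>L M f"
  let ?S = "{-1, 1 :: real}"
  define Z where "Z s t u = (\<lambda>\<omega>. a \<omega> + s * b \<omega> + t * c \<omega> + u * d \<omega>)" for s t u
  define q where "q = ?E (\<lambda>\<omega>. a \<omega> * a \<omega>) + ?E (\<lambda>\<omega>. b \<omega> * b \<omega>)
    + ?E (\<lambda>\<omega>. c \<omega> * c \<omega>) + ?E (\<lambda>\<omega>. d \<omega> * d \<omega>)"
  have span: "Z s t u \<in> lin_span B" for s t u
    unfolding Z_def by (intro lin_span_add lin_span_scale assms)
  note L = span_L4[OF assms(1)] span_L4[OF assms(2)] span_L4[OF assms(3)] span_L4[OF assms(4)]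
  have sq: "?E (\<lambda>\<omega>. (Z s t u \<omega>)\<^sup>2) =
      q + 2 * s * ?E (\<lambda>\<omega>. a \<omega> * b \<omega>) + 2 * t * ?E (\<lambda>\<omega>. a \<omega> * c \<omega>)
      + 2 * u * ?E (\<lambda>\<omega>. a \<omega> * d \<omega>) + 2 * s * t * ?E (\<lambda>\<omega>. b \<omega> * c \<omega>)
      + 2 * s * u * ?E (\<lambda>\<omega>. b \<omega> * d \<omega>) + 2 * t * u * ?E (\<lambda>\<omega>. c \<omega> * d \<omega>)"
    if "s \<in> ?S" "t \<in> ?S" "u \<in> ?S" for s t u
  proof -
    have 1: "s\<^sup>2 = 1" "t\<^sup>2 = 1" "u\<^sup>2 = 1" using that by auto
    have "(\<lambda>\<omega>. (Z s t u \<omega>)\<^sup>2) = (\<lambda>\<omega>. a \<omega> * a \<omega> + s\<^sup>2 * (b \<omega> * b \<omega>) + t\<^sup>2 * (c \<omega> * c \<omega>)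
      + u\<^sup>2 * (d \<omega> * d \<omega>) + 2 * s * (a \<omega> * b \<omega>) + 2 * t * (a \<omega> * c \<omega>)
      + 2 * u * (a \<omega> * d \<omega>) + 2 * s * t * (b \<omega> * c \<omega>)
      + 2 * s * u * (b \<omega> * d \<omega>) + 2 * t * u * (c \<omega> * d \<omega>))"
      unfolding Z_def by (intro ext) (simp add: power2_eq_square algebra_simps)
    then show ?thesis using L unfolding 1 q_def by (simp add: L4_prod2)
  qed
  have "192 * ?E (\<lambda>\<omega>. a \<omega> * b \<omega> * c \<omega> * d \<omega>)
      = ?E (\<lambda>\<omega>. 192 * (a \<omega> * b \<omega> * c \<omega> * d \<omega>))"
    by simp
  also have "\<dots> = ?E (\<lambda>\<omega>. \<Sum>s\<in>?S. \<Sum>t\<in>?S. \<Sum>u\<in>?S. s * t * u * Z s t u \<omega> ^ 4)"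
    unfolding Z_def polarisation4 ..
  also have "\<dots> = (\<Sum>s\<in>?S. \<Sum>t\<in>?S. \<Sum>u\<in>?S. s * t * u * ?E (\<lambda>\<omega>. Z s t u \<omega> ^ 4))"
    using span_L4[OF span] by (simp add: L4_def)
  also have "\<dots> = (\<Sum>s\<in>?S. \<Sum>t\<in>?S. \<Sum>u\<in>?S. s * t * u * (3 * (?E (\<lambda>\<omega>. (Z s t u \<omega>)\<^sup>2))\<^sup>2))"
    by (simp add: span_fourth_moment[OF span])
  also have "\<dots> = 192 * (?E (\<lambda>\<omega>. a \<omega> * b \<omega>) * ?E (\<lambda>\<omega>. c \<omega> * d \<omega>) +
    ?E (\<lambda>\<omega>. a \<omega> * c \<omega>) * ?E (\<lambda>\<omega>. b \<omega> * d \<omega>) + ?E (\<lambda>\<omega>. a \<omega> * d \<omega>) * ?E (\<lambda>\<omega>. b \<omega> * c \<omega>))"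
    unfolding polarisation_sq[symmetric, where q = q] by (intro sum.cong refl) (simp only: sq)
  finally show ?thesis by simp
qed

text \<open>If \<open>p\<close> is the covariance matrix of \<open>b\<close> and \<open>q\<close> its inverse, \<open>A\<close> is a chi-square variable
with \<open>n\<close> degrees of freedom divided by \<open>n\<close>. Instead of diagonalising \<open>p\<close>, Isserlis' formula
is contracted with \<open>q\<close> twice: the first pairing gives the square of the trace of the identity,
\<open>n\<^sup>2\<close>, and each of the other two gives the trace, \<open>n\<close>.\<close>

lemma normalised_quadratic_form:
  fixes b :: "nat \<Rightarrow> 'a \<Rightarrow> real" and p q :: "nat \<Rightarrow> nat \<Rightarrow> real"
  assumes b: "\<And>i. b i \<in> lin_span B"
    and p: "\<And>i j. i < n \<Longrightarrow> j < n \<Longrightarrow> (\<integral>\<omega>. b i \<omega> * b j \<omega> \<partial>M) = p i j"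
    and inv: "\<And>i k. i < n \<Longrightarrow> k < n \<Longrightarrow> (\<Sum>j<n. q i j * p j k) = (if i = k then 1 else 0)"
    and q_sym: "\<And>i j. i < n \<Longrightarrow> j < n \<Longrightarrow> q i j = q j i"
    and n: "n > 0"
  defines "A \<equiv> (\<lambda>\<omega>. 1 / real n * (\<Sum>i<n. \<Sum>j<n. q i j * b i \<omega> * b j \<omega>))"
  shows "integrable M (\<lambda>\<omega>. (A \<omega>)\<^sup>2)"
    and "(\<integral>\<omega>. (A \<omega>)\<^sup>2 \<partial>M) = 1 + 2 / real n"
    and "integrable M (\<lambda>\<omega>. (A \<omega> - 1)\<^sup>2)"
    and "(\<integral>\<omega>. (A \<omega> - 1)\<^sup>2 \<partial>M) = 2 / real n"
proof -
  note L = span_L4[OF b]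
  have int2: "integrable M (\<lambda>\<omega>. b i \<omega> * b j \<omega>)" for i j by (intro L4_prod2 L)
  have int4: "integrable M (\<lambda>\<omega>. b i \<omega> * b j \<omega> * b k \<omega> * b l \<omega>)" for i j k l by (intro L4_prod4 L)
  have p_sym: "p i j = p j i" if "i < n" "j < n" for i j
    unfolding p[OF that, symmetric] p[OF that(2,1), symmetric] by (simp add: mult.commute)
  have A1: "A \<omega> = 1 / real n * (\<Sum>i<n. \<Sum>j<n. q i j * (b i \<omega> * b j \<omega>))" for \<omega>
    unfolding A_def by (simp add: mult.assoc)
  have A2: "(A \<omega>)\<^sup>2 = 1 / (real n)\<^sup>2 *
      (\<Sum>i<n. \<Sum>j<n. \<Sum>k<n. \<Sum>l<n. q i j * q k l * (b i \<omega> * b j \<omega> * b k \<omega> * b l \<omega>))" for \<omega>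
  proof -
    let ?f = "\<lambda>i j. q i j * (b i \<omega> * b j \<omega>)"
    have "(\<Sum>i<n. \<Sum>j<n. ?f i j)\<^sup>2 = (\<Sum>i<n. \<Sum>j<n. ?f i j * (\<Sum>k<n. \<Sum>l<n. ?f k l))"
      unfolding power2_eq_square by (simp only: sum_distrib_right)
    also have "\<dots> = (\<Sum>i<n. \<Sum>j<n. \<Sum>k<n. \<Sum>l<n. ?f i j * ?f k l)"
      by (simp only: sum_distrib_left)
    also have "\<dots> = (\<Sum>i<n. \<Sum>j<n. \<Sum>k<n. \<Sum>l<n. q i j * q k l * (b i \<omega> * b j \<omega> * b k \<omega> * b l \<omega>))"
      by (intro sum.cong refl) (simp only: ac_simps)
    finally show ?thesis unfolding A1 power_mult_distrib by (simp add: power_one_over)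
  qed
  show intA2: "integrable M (\<lambda>\<omega>. (A \<omega>)\<^sup>2)" unfolding A2 by (intro integrable_mult_right Bochner_Integration.integrable_sum int4)
  have EA: "(\<integral>\<omega>. A \<omega> \<partial>M) = 1" and intA: "integrable M A"
  proof -
    have "(\<integral>\<omega>. A \<omega> \<partial>M) = 1 / real n * (\<Sum>i<n. \<Sum>j<n. q i j * p j i)"
    proof -
      have "(\<integral>\<omega>. A \<omega> \<partial>M) = 1 / real n * (\<Sum>i<n. \<Sum>j<n. q i j * (\<integral>\<omega>. b i \<omega> * b j \<omega> \<partial>M))"
        unfolding A1 by (simp add: int2)
      also have "(\<Sum>i<n. \<Sum>j<n. q i j * (\<integral>\<omega>. b i \<omega> * b j \<omega> \<partial>M)) = (\<Sum>i<n. \<Sum>j<n. q i j * p j i)"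
        by (intro sum.cong refl) (metis lessThan_iff p p_sym)
      finally show ?thesis .
    qed
    also have "(\<Sum>i<n. \<Sum>j<n. q i j * p j i) = real n" by (simp add: inv)
    finally show "(\<integral>\<omega>. A \<omega> \<partial>M) = 1" using n by simp
    show "integrable M A" unfolding A1 by (intro integrable_mult_right Bochner_Integration.integrable_sum int2)
  qed
  show EA2: "(\<integral>\<omega>. (A \<omega>)\<^sup>2 \<partial>M) = 1 + 2 / real n"
  proof -
    have "(\<integral>\<omega>. (A \<omega>)\<^sup>2 \<partial>M) = 1 / (real n)\<^sup>2 * (\<Sum>i<n. \<Sum>j<n. \<Sum>k<n. \<Sum>l<n.
        q i j * q k l * (p i j * p k l + p i k * p j l + p i l * p j k))"
    proof -
      have "(\<integral>\<omega>. (A \<omega>)\<^sup>2 \<partial>M) = 1 / (real n)\<^sup>2 * (\<Sum>i<n. \<Sum>j<n. \<Sum>k<n. \<Sum>l<n.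
        q i j * q k l * (\<integral>\<omega>. b i \<omega> * b j \<omega> * b k \<omega> * b l \<omega> \<partial>M))"
        unfolding A2 by (simp add: int4)
      also have "\<dots> = 1 / (real n)\<^sup>2 * (\<Sum>i<n. \<Sum>j<n. \<Sum>k<n. \<Sum>l<n.
        q i j * q k l * (p i j * p k l + p i k * p j l + p i l * p j k))"
        by (intro arg_cong2[where f = "(*)"] sum.cong refl) (simp add: isserlis[OF b b b b] p)
      finally show ?thesis .
    qed
    also have "(\<Sum>i<n. \<Sum>j<n. \<Sum>k<n. \<Sum>l<n.
        q i j * q k l * (p i j * p k l + p i k * p j l + p i l * p j k))
      = (\<Sum>i<n. \<Sum>j<n. \<Sum>k<n. \<Sum>l<n. q i j * q k l * (p i j * p k l))
      + (\<Sum>i<n. \<Sum>j<n. \<Sum>k<n. \<Sum>l<n. q i j * q k l * (p i k * p j l))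
      + (\<Sum>i<n. \<Sum>j<n. \<Sum>k<n. \<Sum>l<n. q i j * q k l * (p i l * p j k))"
      by (simp add: sum.distrib distrib_left)
    also have "(\<Sum>i<n. \<Sum>j<n. \<Sum>k<n. \<Sum>l<n. q i j * q k l * (p i j * p k l))
        = (\<Sum>i<n. \<Sum>j<n. q i j * p j i) * (\<Sum>k<n. \<Sum>l<n. q k l * p l k)"
    proof -
      have "(\<Sum>i<n. \<Sum>j<n. q i j * p j i) = (\<Sum>i<n. \<Sum>j<n. q i j * p i j)"
        by (intro sum.cong refl) (metis lessThan_iff p_sym)
      moreover have "(\<Sum>i<n. \<Sum>j<n. q i j * p i j) * (\<Sum>k<n. \<Sum>l<n. q k l * p k l)
        = (\<Sum>i<n. \<Sum>j<n. q i j * p i j * (\<Sum>k<n. \<Sum>l<n. q k l * p k l))"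
        by (simp only: sum_distrib_right)
      moreover have "\<dots> = (\<Sum>i<n. \<Sum>j<n. \<Sum>k<n. \<Sum>l<n. q i j * p i j * (q k l * p k l))"
        by (simp only: sum_distrib_left)
      moreover have "\<dots> = (\<Sum>i<n. \<Sum>j<n. \<Sum>k<n. \<Sum>l<n. q i j * q k l * (p i j * p k l))"
        by (intro sum.cong refl) (simp only: ac_simps)
      ultimately show ?thesis by simp
    qed
    also have "\<dots> = (real n)\<^sup>2" by (simp add: inv power2_eq_square)
    also have "(\<Sum>i<n. \<Sum>j<n. \<Sum>k<n. \<Sum>l<n. q i j * q k l * (p i k * p j l))
        = (\<Sum>i<n. \<Sum>k<n. \<Sum>l<n. (\<Sum>j<n. q i j * p j l) * (q l k * p k i))"
    proof (rule sum.cong[OF refl])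
      fix i assume i: "i \<in> {..<n}"
      have "(\<Sum>j<n. \<Sum>k<n. \<Sum>l<n. q i j * q k l * (p i k * p j l))
        = (\<Sum>k<n. \<Sum>j<n. \<Sum>l<n. q i j * q k l * (p i k * p j l))" by (rule sum.swap)
      also have "\<dots> = (\<Sum>k<n. \<Sum>l<n. \<Sum>j<n. q i j * q k l * (p i k * p j l))"
        by (intro sum.cong refl sum.swap)
      also have "\<dots> = (\<Sum>k<n. \<Sum>l<n. (\<Sum>j<n. q i j * p j l) * (q l k * p k i))"
        unfolding sum_distrib_right
      proof (intro sum.cong refl)
        fix j k l assume "j \<in> {..<n}" "k \<in> {..<n}" "l \<in> {..<n}"
        then have e: "p i k = p k i" "q k l = q l k" using i p_sym q_sym by auto
        show "q i j * q k l * (p i k * p j l) = q i j * p j l * (q l k * p k i)"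
          unfolding e by (simp only: ac_simps)
      qed
      finally show "(\<Sum>j<n. \<Sum>k<n. \<Sum>l<n. q i j * q k l * (p i k * p j l))
        = (\<Sum>k<n. \<Sum>l<n. (\<Sum>j<n. q i j * p j l) * (q l k * p k i))" .
    qed
    also have "\<dots> = (\<Sum>i<n. \<Sum>k<n. q i k * p k i)"
      by (intro sum.cong refl) (simp add: inv mult_delta_left)
    also have "\<dots> = real n" by (simp add: inv)
    also have "(\<Sum>i<n. \<Sum>j<n. \<Sum>k<n. \<Sum>l<n. q i j * q k l * (p i l * p j k))
        = (\<Sum>i<n. \<Sum>k<n. \<Sum>l<n. (\<Sum>j<n. q i j * p j k) * (q k l * p l i))"
    proof (rule sum.cong[OF refl])
      fix i assume i: "i \<in> {..<n}"
      have "(\<Sum>j<n. \<Sum>k<n. \<Sum>l<n. q i j * q k l * (p i l * p j k))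
        = (\<Sum>k<n. \<Sum>j<n. \<Sum>l<n. q i j * q k l * (p i l * p j k))" by (rule sum.swap)
      also have "\<dots> = (\<Sum>k<n. \<Sum>l<n. \<Sum>j<n. q i j * q k l * (p i l * p j k))"
        by (intro sum.cong refl sum.swap)
      also have "\<dots> = (\<Sum>k<n. \<Sum>l<n. (\<Sum>j<n. q i j * p j k) * (q k l * p l i))"
        unfolding sum_distrib_right
      proof (intro sum.cong refl)
        fix j k l assume "j \<in> {..<n}" "k \<in> {..<n}" "l \<in> {..<n}"
        then have e: "p i l = p l i" using i p_sym by auto
        show "q i j * q k l * (p i l * p j k) = q i j * p j k * (q k l * p l i)"
          unfolding e by (simp only: ac_simps)
      qed
      finally show "(\<Sum>j<n. \<Sum>k<n. \<Sum>l<n. q i j * q k l * (p i l * p j k))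
        = (\<Sum>k<n. \<Sum>l<n. (\<Sum>j<n. q i j * p j k) * (q k l * p l i))" .
    qed
    also have "\<dots> = (\<Sum>i<n. \<Sum>k<n. (\<Sum>j<n. q i j * p j k) * (\<Sum>l<n. q k l * p l i))"
      by (simp add: sum_distrib_left)
    also have "\<dots> = (\<Sum>i<n. \<Sum>k<n. if i = k then 1 else 0)"
      by (intro sum.cong refl) (simp add: inv mult_delta_left)
    also have "\<dots> = real n" by simp
    also have "1 / (real n)\<^sup>2 * ((real n)\<^sup>2 + real n + real n) = 1 + 2 / real n"
      using n by (simp add: field_simps power2_eq_square)
    finally show ?thesis .
  qed
  have eq: "(A \<omega> - 1)\<^sup>2 = (A \<omega>)\<^sup>2 - 2 * A \<omega> + 1" for \<omega>
    by (simp add: power2_diff)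
  show "integrable M (\<lambda>\<omega>. (A \<omega> - 1)\<^sup>2)"
    unfolding eq using intA2 intA by (intro Bochner_Integration.integrable_add Bochner_Integration.integrable_diff) auto
  show "(\<integral>\<omega>. (A \<omega> - 1)\<^sup>2 \<partial>M) = 2 / real n"
    unfolding eq using intA2 intA EA EA2 by (simp add: prob_space)
qed

end

section \<open>Spectral lower bound for fractional Gaussian noise\<close>

text \<open>The covariance at lag \<open>k\<close> of the increments of fractional Brownian motion over unit steps.\<close>

definition fgn_cov :: "real \<Rightarrow> real \<Rightarrow> real" where
  "fgn_cov H k = ((\<bar>k\<bar> + 1) powr (2 * H) + \<bar>\<bar>k\<bar> - 1\<bar> powr (2 * H) - 2 * \<bar>k\<bar> powr (2 * H)) / 2"

text \<open>The integrand of the representation of \<open>\<bar>t\<bar> powr (2 * H)\<close>, up to a constant, as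
the integral of \<open>(1 - cos (t * x)) * x powr (- 2 * H - 1)\<close> over \<open>x > 0\<close>. At \<open>t = 1\<close> it is, up
to the same constant, the spectral density of the unit-step noise before frequencies are folded
into \<open>[0, pi]\<close>.\<close>

definition frac_kernel :: "real \<Rightarrow> real \<Rightarrow> real \<Rightarrow> real" where
  "frac_kernel H t x = indicator {0<..} x * ((1 - cos (t * x)) * x powr (- (2 * H) - 1))"

lemma one_minus_cos_eq: "1 - cos x = 2 * (sin (x / 2))\<^sup>2" for x :: real
  using cos_double_sin[of "x / 2"] by simp

lemma one_minus_cos_le: "1 - cos x \<le> x\<^sup>2 / 2" for x :: real
proof -
  have "(sin (x / 2))\<^sup>2 \<le> (x / 2)\<^sup>2"
    using abs_sin_x_le_abs_x[of "x / 2"] by (simp only: abs_le_square_iff)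
  then show ?thesis unfolding one_minus_cos_eq by (simp add: power_divide)
qed

text \<open>The cubic Taylor bound gives \<open>sin y \<ge> y - y^3 / 6\<close>, which is at least \<open>y / 2\<close>
for \<open>y\<^sup>2 \<le> 3\<close>; this covers \<open>y = x / 2\<close> since \<open>pi / 2 \<le> 8/5\<close>.\<close>

lemma one_minus_cos_ge:
  assumes "0 \<le> x" "x \<le> pi" shows "x\<^sup>2 / 8 \<le> 1 - cos x"
proof -
  define y where "y = x / 2"
  have y: "0 \<le> y" "y \<le> 8/5" using assms pi_approx by (auto simp: y_def)
  have "\<bar>sin y - (\<Sum>m<3. sin_coeff m * y ^ m)\<bar> \<le> inverse (fact 3) * \<bar>y\<bar> ^ 3"
    by (rule Maclaurin_sin_bound)
  then have "\<bar>sin y - y\<bar> \<le> y ^ 3 / 6"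
    using y by (simp add: sin_coeff_def eval_nat_numeral field_simps)
  moreover have "y ^ 3 / 6 \<le> y / 2"
  proof -
    have "y * y \<le> (8/5) * (8/5)" using y by (intro mult_mono) auto
    then have "y * (y * y) \<le> y * 3" using y by (intro mult_left_mono) auto
    then show ?thesis by (simp add: power3_eq_cube)
  qed
  ultimately have "y / 2 \<le> sin y" by linarith
  then have "(y / 2)\<^sup>2 \<le> (sin y)\<^sup>2" using y by (intro power_mono) auto
  then show ?thesis unfolding one_minus_cos_eq y_def by (simp add: power_divide)
qed

lemma frac_kernel_nonneg: "frac_kernel H t x \<ge> 0"
  by (auto simp: frac_kernel_def indicator_def)

lemma frac_kernel_measurable [measurable]: "frac_kernel H t \<in> borel_measurable borel"
  unfolding frac_kernel_def by measurable

text \<open>Near 0 the kernel is at most \<open>x powr (1 - 2 * H)\<close>, integrable because \<open>H < 1\<close>; at infinity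
it is at most \<open>2 * x powr (- 2 * H - 1)\<close>, integrable because \<open>H > 0\<close>.\<close>

lemma integrable_frac_kernel_1:
  assumes "0 < H" "H < 1" shows "integrable lborel (frac_kernel H 1)"
proof (rule Bochner_Integration.integrable_bound)
  let ?f = "\<lambda>x::real. indicator {0..1} x * x powr (1 - 2 * H) :: real"
  let ?g = "\<lambda>x::real. indicator {1..} x * x powr (- (2 * H) - 1) :: real"
  have "(\<lambda>x. x powr (1 - 2 * H)) integrable_on {0..1::real}"
    using has_integral_powr_from_0[of "1 - 2 * H" 1] assms by (auto simp: integrable_on_def)
  then have "(\<lambda>x. x powr (1 - 2 * H)) absolutely_integrable_on {0..1::real}"
    by (intro nonnegative_absolutely_integrable_1) auto
  then have "integrable lborel ?f"
    unfolding set_integrable_def by (subst (asm) integrable_completion) auto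
  moreover have "(\<lambda>x. x powr (- (2 * H) - 1)) integrable_on {1::real..}"
    using has_integral_powr_to_inf[of "- (2 * H) - 1" 1] assms by (auto simp: integrable_on_def)
  then have "(\<lambda>x. x powr (- (2 * H) - 1)) absolutely_integrable_on {1::real..}"
    by (intro nonnegative_absolutely_integrable_1) auto
  then have "integrable lborel ?g"
    unfolding set_integrable_def by (subst (asm) integrable_completion) auto
  ultimately show "integrable lborel (\<lambda>x. ?f x + 2 * ?g x)" by simp
  show "AE x in lborel. norm (frac_kernel H 1 x) \<le> norm (?f x + 2 * ?g x)"
  proof (rule AE_I2)
    fix x :: real
    have "frac_kernel H 1 x \<le> ?f x + 2 * ?g x"
    proof (cases "0 < x")
      case True
      show ?thesis
      proof (cases "x \<le> 1")
        case le: True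
        have "(1 - cos x) * x powr (- (2 * H) - 1) \<le> x\<^sup>2 * x powr (- (2 * H) - 1)"
        proof (intro mult_right_mono)
          have "1 - cos x \<le> x\<^sup>2 / 2" by (rule one_minus_cos_le)
          also have "\<dots> \<le> x\<^sup>2" by simp
          finally show "1 - cos x \<le> x\<^sup>2" .
        qed simp
        also have "x\<^sup>2 * x powr (- (2 * H) - 1) = x powr (1 - 2 * H)"
          using True by (simp flip: powr_numeral powr_add)
        finally show ?thesis using True le by (auto simp: frac_kernel_def indicator_def)
      next
        case False
        have "1 - cos x \<le> 2" using cos_ge_minus_one[of x] by linarith
        then have "(1 - cos x) * x powr (- (2 * H) - 1) \<le> 2 * x powr (- (2 * H) - 1)"
          by (intro mult_right_mono) auto
        then show ?thesis using True False by (auto simp: frac_kernel_def indicator_def)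
      qed
    qed (auto simp: frac_kernel_def indicator_def)
    moreover have "0 \<le> ?f x + 2 * ?g x" by (auto simp: indicator_def)
    ultimately show "norm (frac_kernel H 1 x) \<le> norm (?f x + 2 * ?g x)"
      using frac_kernel_nonneg[of H 1 x] by simp
  qed
qed auto

definition spectral_const :: "real \<Rightarrow> real" where
  "spectral_const H = (\<integral>x. frac_kernel H 1 x \<partial>lborel)"

lemma frac_kernel_abs: "frac_kernel H \<bar>t\<bar> x = frac_kernel H t x"
  by (simp add: frac_kernel_def abs_if)

text \<open>The substitution \<open>x = \<bar>t\<bar> * y\<close> in the integral at \<open>t = 1\<close> produces the power
of \<open>\<bar>t\<bar>\<close>.\<close>

lemma
  assumes H: "0 < H" "H < 1"
  shows integrable_frac_kernel: "integrable lborel (frac_kernel H t)"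
    and integral_frac_kernel:
      "(\<integral>x. frac_kernel H t x \<partial>lborel) = spectral_const H * \<bar>t\<bar> powr (2 * H)"
proof -
  have "integrable lborel (frac_kernel H \<bar>t\<bar>) \<and>
      (\<integral>x. frac_kernel H \<bar>t\<bar> x \<partial>lborel) = spectral_const H * \<bar>t\<bar> powr (2 * H)"
  proof (cases "t = 0")
    case True then show ?thesis by (simp add: frac_kernel_def[abs_def])
  next
    case False
    define c where "c = \<bar>t\<bar>"
    have c: "c > 0" using False by (simp add: c_def)
    have scale: "frac_kernel H 1 (0 + c * x) = c powr (- (2 * H) - 1) * frac_kernel H c x" for x
      using c by (auto simp: frac_kernel_def indicator_def powr_mult zero_less_mult_iff)
    have "integrable lborel (\<lambda>x. frac_kernel H 1 (0 + c * x))"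
      using c by (intro lborel_integrable_real_affine integrable_frac_kernel_1 H) auto
    then have i: "integrable lborel (frac_kernel H c)"
      unfolding scale using c by simp
    have "spectral_const H = c * (\<integral>x. frac_kernel H 1 (0 + c * x) \<partial>lborel)"
      unfolding spectral_const_def using c by (subst lborel_integral_real_affine[of c _ 0]) auto
    also have "\<dots> = c * (c powr (- (2 * H) - 1) * (\<integral>x. frac_kernel H c x \<partial>lborel))"
      unfolding scale by simp
    also have "\<dots> = c powr (- (2 * H)) * (\<integral>x. frac_kernel H c x \<partial>lborel)"
      using c by (simp add: powr_diff powr_minus field_simps)
    finally have "(\<integral>x. frac_kernel H c x \<partial>lborel) = spectral_const H * c powr (2 * H)"
      using c by (simp add: powr_minus field_simps)
    with i show ?thesis unfolding c_def by simp
  qed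
  then show "integrable lborel (frac_kernel H t)"
    and "(\<integral>x. frac_kernel H t x \<partial>lborel) = spectral_const H * \<bar>t\<bar> powr (2 * H)"
    by (simp_all add: frac_kernel_abs[abs_def])
qed

text \<open>The covariance of the noise is a second difference of \<open>\<bar>t\<bar> powr (2 * H) / 2\<close>; taking that
difference under the integral turns the kernel into a cosine transform with positive weight.\<close>

lemma frac_kernel_second_difference:
  "(frac_kernel H (\<bar>k\<bar> + 1) x + frac_kernel H (\<bar>k\<bar> - 1) x - 2 * frac_kernel H \<bar>k\<bar> x) / 2
    = cos (k * x) * frac_kernel H 1 x"
proof -
  have k: "cos (\<bar>k\<bar> * x) = cos (k * x)" by (simp add: abs_if)
  have "cos ((\<bar>k\<bar> + 1) * x) + cos ((\<bar>k\<bar> - 1) * x) = 2 * cos (k * x) * cos x"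
    unfolding k[symmetric] by (simp add: distrib_right left_diff_distrib cos_add cos_diff)
  moreover have "((1 - a) + (1 - b) - 2 * (1 - c)) / 2 = c * (1 - d)" if "a + b = 2 * c * d" for a b c d :: real
    using that by (simp add: field_simps)
  ultimately have "((1 - cos ((\<bar>k\<bar> + 1) * x)) + (1 - cos ((\<bar>k\<bar> - 1) * x)) - 2 * (1 - cos (\<bar>k\<bar> * x))) / 2
      = cos (k * x) * (1 - cos x)" unfolding k by blast
  then have "indicator {0<..} x * x powr (- (2 * H) - 1) *
      (((1 - cos ((\<bar>k\<bar> + 1) * x)) + (1 - cos ((\<bar>k\<bar> - 1) * x)) - 2 * (1 - cos (\<bar>k\<bar> * x))) / 2)
      = indicator {0<..} x * x powr (- (2 * H) - 1) * (cos (k * x) * (1 - cos x))" by simp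
  then show ?thesis unfolding frac_kernel_def by (simp add: algebra_simps)
qed

lemma
  assumes H: "0 < H" "H < 1"
  shows integrable_fgn_spectral: "integrable lborel (\<lambda>x. cos (k * x) * frac_kernel H 1 x)"
    and fgn_cov_spectral: "(\<integral>x. cos (k * x) * frac_kernel H 1 x \<partial>lborel) = spectral_const H * fgn_cov H k"
  unfolding frac_kernel_second_difference[symmetric]
  using integrable_frac_kernel[OF H]
  by (simp_all add: integral_frac_kernel[OF H] fgn_cov_def algebra_simps)

text \<open>The squared modulus of the trigonometric polynomial with coefficients \<open>v\<close>, written so that
the quadratic form of any stationary covariance is its integral against the spectral density.\<close>

definition trig_square :: "nat \<Rightarrow> (nat \<Rightarrow> real) \<Rightarrow> real \<Rightarrow> real" where
  "trig_square n v x = (\<Sum>i<n. \<Sum>j<n. v i * v j * cos ((real i - real j) * x))"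

lemma trig_square_eq:
  "trig_square n v x = (\<Sum>i<n. v i * cos (real i * x))\<^sup>2 + (\<Sum>i<n. v i * sin (real i * x))\<^sup>2"
  unfolding trig_square_def power2_eq_square sum_product sum.distrib[symmetric]
    left_diff_distrib cos_diff
  by (intro sum.cong refl) (simp add: algebra_simps)

lemma trig_square_nonneg: "trig_square n v x \<ge> 0"
  unfolding trig_square_eq by simp

lemma trig_square_le: "trig_square n v x \<le> real n * (\<Sum>i<n. (v i)\<^sup>2)"
proof -
  have "trig_square n v x \<le> (\<Sum>i<n. (v i)\<^sup>2) * (\<Sum>i<n. (cos (real i * x))\<^sup>2)
      + (\<Sum>i<n. (v i)\<^sup>2) * (\<Sum>i<n. (sin (real i * x))\<^sup>2)"
    unfolding trig_square_eq by (intro add_mono Cauchy_Schwarz_ineq_sum)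
  also have "\<dots> = (\<Sum>i<n. (v i)\<^sup>2) * (\<Sum>i<n. (cos (real i * x))\<^sup>2 + (sin (real i * x))\<^sup>2)"
    by (simp only: sum.distrib distrib_left)
  finally show ?thesis by (simp add: mult.commute)
qed

lemma trig_square_continuous: "continuous_on S (trig_square n v)"
  unfolding trig_square_def by (intro continuous_intros)

lemma has_integral_cos_nat_diff:
  "((\<lambda>x. cos ((real i - real j) * x)) has_integral (if i = j then pi else 0)) {0..pi}"
proof (cases "i = j")
  case True
  then show ?thesis using has_integral_const_real[of "1::real" 0 pi] by simp
next
  case False
  define k where "k = real i - real j"
  have k: "k \<noteq> 0" "k \<in> \<int>" using False by (auto simp: k_def)
  have "((\<lambda>x. cos (k * x)) has_integral (sin (k * pi) / k - sin (k * 0) / k)) {0..pi}"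
    using k by (intro fundamental_theorem_of_calculus)
      (auto intro!: derivative_eq_intros simp flip: has_real_derivative_iff_has_vector_derivative)
  moreover have "sin (k * pi) = 0" using k by (simp add: sin_times_pi_eq_0)
  ultimately show ?thesis using False by (simp add: k_def)
qed

lemma has_integral_trig_square: "(trig_square n v has_integral pi * (\<Sum>i<n. (v i)\<^sup>2)) {0..pi}"
proof -
  have "(trig_square n v has_integral
      (\<Sum>i<n. \<Sum>j<n. v i * v j * (if i = j then pi else 0))) {0..pi}"
    unfolding trig_square_def
    by (intro has_integral_sum has_integral_mult_right has_integral_cos_nat_diff finite_lessThan)
  then show ?thesis by (simp add: sum_distrib_left power2_eq_square mult_delta_right ac_simps cong: if_cong)
qed

text \<open>Uncertainty principle: the total mass on \<open>[0, pi]\<close> is \<open>pi * |v|^2\<close> and the pointwise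
bound is \<open>n * |v|^2\<close>, so frequencies below \<open>pi / (2 * n)\<close> carry at most half of the mass.\<close>

lemma integral_trig_square_ge:
  assumes n: "n > 0"
  shows "pi / 2 * (\<Sum>i<n. (v i)\<^sup>2) \<le> integral {pi / (2 * real n)..pi} (trig_square n v)"
proof -
  let ?r = "pi / (2 * real n)"
  have r: "0 \<le> ?r" "?r \<le> pi" using n by (auto simp: field_simps)
  have "integral {0..?r} (trig_square n v) + integral {?r..pi} (trig_square n v) = integral {0..pi} (trig_square n v)"
    using r by (intro Henstock_Kurzweil_Integration.integral_combine integrable_continuous_real trig_square_continuous)
  moreover have "integral {0..pi} (trig_square n v) = pi * (\<Sum>i<n. (v i)\<^sup>2)"
    using has_integral_trig_square by (rule integral_unique)
  moreover have "integral {0..?r} (trig_square n v) \<le> integral {0..?r} (\<lambda>_. real n * (\<Sum>i<n. (v i)\<^sup>2))"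
    by (intro integral_le integrable_continuous_real trig_square_continuous trig_square_le) auto
  moreover have "integral {0..?r} (\<lambda>_. real n * (\<Sum>i<n. (v i)\<^sup>2)) = pi / 2 * (\<Sum>i<n. (v i)\<^sup>2)"
    using r n by simp
  ultimately show ?thesis by linarith
qed

text \<open>By \<open>one_minus_cos_ge\<close> the kernel is at least \<open>x powr (1 - 2 * H) / 8\<close>. That power is smallest at the
left end of the interval, where it is of order \<open>n powr (- (1 - 2 * H))\<close>, if \<open>H \<le> 1/2\<close>, and at \<open>pi\<close>
otherwise.\<close>

lemma frac_kernel_ge:
  assumes H: "0 < H" "H < 1" and n: "n > 0" and x: "x \<in> {pi / (2 * real n)..pi}"
  shows "frac_kernel H 1 x \<ge> real n powr (- max 0 (1 - 2 * H)) / (8 * pi)"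
proof -
  have "0 < pi / (2 * real n)" using n by simp
  then have x0: "0 < x" using x by (auto simp: intro: less_le_trans)
  have "real n powr (- max 0 (1 - 2 * H)) / pi \<le> x powr (1 - 2 * H)"
  proof (cases "H \<le> 1/2")
    case True
    have "real n powr (- max 0 (1 - 2 * H)) / pi \<le> real n powr (- (1 - 2 * H))"
    proof -
      have "y / pi \<le> y" if "0 \<le> y" for y
        using that pi_gt3 divide_left_mono[of 1 pi y] by simp
      then show ?thesis using True by simp
    qed
    also have "\<dots> = (1 / real n) powr (1 - 2 * H)"
      unfolding powr_minus_divide using n by (simp add: powr_divide)
    also have "\<dots> \<le> x powr (1 - 2 * H)"
    proof (intro powr_mono2)
      have "1 / real n \<le> pi / (2 * real n)" using n pi_gt3 by (simp add: field_simps)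
      then show "1 / real n \<le> x" using x by auto
    qed (use True in auto)
    finally show ?thesis .
  next
    case False
    have "real n powr (- max 0 (1 - 2 * H)) / pi = pi powr (-1)" using False n
      by (simp add: powr_minus_divide)
    also have "\<dots> \<le> pi powr (1 - 2 * H)" using H pi_gt3 by (intro powr_mono) auto
    also have "\<dots> \<le> x powr (1 - 2 * H)" using False x x0 by (intro powr_mono2') auto
    finally show ?thesis .
  qed
  then have "real n powr (- max 0 (1 - 2 * H)) / (8 * pi) \<le> x powr (1 - 2 * H) / 8" by simp
  also have "\<dots> = x\<^sup>2 / 8 * x powr (- (2 * H) - 1)"
    using x0 by (simp flip: powr_numeral powr_add)
  also have "\<dots> \<le> (1 - cos x) * x powr (- (2 * H) - 1)"
    using x x0 by (intro mult_right_mono one_minus_cos_ge) auto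
  also have "\<dots> = frac_kernel H 1 x" using x0 by (simp add: frac_kernel_def)
  finally show ?thesis .
qed

lemma spectral_quadratic_form:
  assumes H: "0 < H" "H < 1"
  shows "integrable lborel (\<lambda>x. trig_square n v x * frac_kernel H 1 x)"
    and "(\<integral>x. trig_square n v x * frac_kernel H 1 x \<partial>lborel)
      = spectral_const H * (\<Sum>i<n. \<Sum>j<n. v i * v j * fgn_cov H (real i - real j))"
proof -
  have eq: "trig_square n v x * frac_kernel H 1 x = (\<Sum>i<n. \<Sum>j<n. v i * v j *
      (cos ((real i - real j) * x) * frac_kernel H 1 x))" for x
    unfolding trig_square_def by (simp add: sum_distrib_right mult.assoc)
  show "integrable lborel (\<lambda>x. trig_square n v x * frac_kernel H 1 x)"
    unfolding eq using integrable_fgn_spectral[OF H] by simp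
  show "(\<integral>x. trig_square n v x * frac_kernel H 1 x \<partial>lborel)
      = spectral_const H * (\<Sum>i<n. \<Sum>j<n. v i * v j * fgn_cov H (real i - real j))"
    unfolding eq using integrable_fgn_spectral[OF H]
    by (simp add: fgn_cov_spectral[OF H] sum_distrib_left mult.left_commute)
qed

lemma spectral_lower_bound:
  assumes H: "0 < H" "H < 1" and n: "n > 0"
  shows "real n powr (- max 0 (1 - 2 * H)) / 16 * (\<Sum>i<n. (v i)\<^sup>2)
    \<le> spectral_const H * (\<Sum>i<n. \<Sum>j<n. v i * v j * fgn_cov H (real i - real j))"
proof -
  let ?m = "real n powr (- max 0 (1 - 2 * H)) / (8 * pi)" and ?I = "{pi / (2 * real n)..pi}"
  have si: "set_integrable lborel ?I (trig_square n v)"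
    by (intro borel_integrable_atLeastAtMost' trig_square_continuous)
  have "real n powr (- max 0 (1 - 2 * H)) / 16 * (\<Sum>i<n. (v i)\<^sup>2) = ?m * (pi / 2 * (\<Sum>i<n. (v i)\<^sup>2))"
    by (simp add: field_simps)
  also have "\<dots> \<le> ?m * integral ?I (trig_square n v)"
    using n by (intro mult_left_mono integral_trig_square_ge) auto
  also have "\<dots> = (\<integral>x. ?m * (indicator ?I x *\<^sub>R trig_square n v x) \<partial>lborel)"
    using set_borel_integral_eq_integral(2)[OF si] by (simp add: set_lebesgue_integral_def)
  also have "\<dots> \<le> (\<integral>x. trig_square n v x * frac_kernel H 1 x \<partial>lborel)"
  proof (intro integral_mono)
    show "integrable lborel (\<lambda>x. ?m * (indicator ?I x *\<^sub>R trig_square n v x))"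
      using si by (simp add: set_integrable_def)
    show "?m * (indicator ?I x *\<^sub>R trig_square n v x) \<le> trig_square n v x * frac_kernel H 1 x" for x
      using mult_left_mono[OF frac_kernel_ge[OF H n, of x] trig_square_nonneg[of n v x]]
        trig_square_nonneg[of n v x] frac_kernel_nonneg[of H 1 x]
      by (cases "x \<in> ?I") (auto simp: mult.commute)
  qed (rule spectral_quadratic_form[OF H])
  finally show ?thesis unfolding spectral_quadratic_form(2)[OF H] .
qed

text \<open>With \<open>n = 1\<close> and \<open>v = 1\<close> the quadratic form of the noise covariance equals 1, so the lower bound is
one for the constant itself.\<close>

lemma spectral_const_pos:
  assumes H: "0 < H" "H < 1" shows "spectral_const H > 0"
  using spectral_lower_bound[OF H, of 1 "\<lambda>_. 1"] by (simp add: fgn_cov_def)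

lemma fgn_cov_coercive:
  assumes H: "0 < H" "H < 1"
  obtains c where "c > 0"
    "\<And>n v. n > 0 \<Longrightarrow> c * real n powr (- max 0 (1 - 2 * H)) * (\<Sum>i<n. (v i)\<^sup>2)
      \<le> (\<Sum>i<n. \<Sum>j<n. v i * v j * fgn_cov H (real i - real j))"
proof
  let ?K = "spectral_const H"
  have K: "?K > 0" by (rule spectral_const_pos[OF H])
  then show "1 / (16 * ?K) > 0" by simp
  show "1 / (16 * ?K) * real n powr (- max 0 (1 - 2 * H)) * (\<Sum>i<n. (v i)\<^sup>2)
      \<le> (\<Sum>i<n. \<Sum>j<n. v i * v j * fgn_cov H (real i - real j))" if "n > 0" for n v
    using spectral_lower_bound[OF H that, of v] K by (simp add: field_simps)
qed

section \<open>Inverses of coercive matrices\<close>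

definition quad_form :: "nat \<Rightarrow> (nat \<Rightarrow> nat \<Rightarrow> real) \<Rightarrow> (nat \<Rightarrow> real) \<Rightarrow> (nat \<Rightarrow> real) \<Rightarrow> real" where
  "quad_form n q v w = (\<Sum>i<n. \<Sum>j<n. q i j * v i * w j)"

lemma quad_form_sym:
  assumes "\<And>i j. i < n \<Longrightarrow> j < n \<Longrightarrow> q i j = q j i"
  shows "quad_form n q v w = quad_form n q w v"
  unfolding quad_form_def by (subst sum.swap) (intro sum.cong refl, simp add: assms mult_ac)

lemma quad_form_lincomb:
  assumes "\<And>i j. i < n \<Longrightarrow> j < n \<Longrightarrow> q i j = q j i"
  shows "quad_form n q (\<lambda>i. a * v i + b * w i) (\<lambda>i. a * v i + b * w i)
    = a\<^sup>2 * quad_form n q v v + 2 * a * b * quad_form n q v w + b\<^sup>2 * quad_form n q w w"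
proof -
  have "quad_form n q (\<lambda>i. a * v i + b * w i) (\<lambda>i. a * v i + b * w i)
    = a\<^sup>2 * quad_form n q v v + a * b * quad_form n q v w + a * b * quad_form n q w v + b\<^sup>2 * quad_form n q w w"
    unfolding quad_form_def
    by (simp add: sum_distrib_left sum.distrib[symmetric] power2_eq_square algebra_simps)
  then show ?thesis using quad_form_sym[OF assms, where v = v and w = w] by simp
qed

locale coercive_inverse =
  fixes n :: nat and p q :: "nat \<Rightarrow> nat \<Rightarrow> real" and lam :: real
  assumes lam_pos: "lam > 0"
    and p_sym: "\<And>i j. i < n \<Longrightarrow> j < n \<Longrightarrow> p i j = p j i"
    and coercive: "\<And>v. lam * (\<Sum>i<n. (v i)\<^sup>2) \<le> quad_form n p v v"
    and qp: "\<And>i k. i < n \<Longrightarrow> k < n \<Longrightarrow> (\<Sum>j<n. q i j * p j k) = (if i = k then 1 else 0)"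
    and pq: "\<And>i k. i < n \<Longrightarrow> k < n \<Longrightarrow> (\<Sum>j<n. p i j * q j k) = (if i = k then 1 else 0)"
begin

lemma q_sym:
  assumes ij: "i < n" "j < n" shows "q i j = q j i"
proof -
  have "q j i = (\<Sum>l<n. (\<Sum>k<n. q i k * p k l) * q j l)"
    using ij by (simp add: qp mult_delta_left)
  also have "\<dots> = (\<Sum>k<n. q i k * (\<Sum>l<n. p k l * q j l))"
    unfolding sum_distrib_left sum_distrib_right by (subst sum.swap) (simp add: mult.assoc)
  also have "\<dots> = (\<Sum>k<n. q i k * (\<Sum>l<n. q j l * p l k))"
  proof (rule sum.cong[OF refl], rule arg_cong2[where f = "(*)", OF refl], rule sum.cong[OF refl])
    fix k l assume "k \<in> {..<n}" "l \<in> {..<n}"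
    then show "p k l * q j l = q j l * p l k" using p_sym[of k l] by simp
  qed
  also have "\<dots> = q i j" using ij by (simp add: qp mult_delta_right)
  finally show ?thesis ..
qed

text \<open>With \<open>u\<close> the image of \<open>w\<close> under the inverse, \<open>w\<close> is the image of \<open>u\<close> under \<open>p\<close>, and the quadratic
form of \<open>q\<close> at \<open>w\<close> is that of \<open>p\<close> at \<open>u\<close>.\<close>

lemma quad_form_inverse_ge:
  fixes w :: "nat \<Rightarrow> real"
  defines "u \<equiv> \<lambda>i. \<Sum>j<n. q i j * w j"
  shows "lam * (\<Sum>i<n. (u i)\<^sup>2) \<le> quad_form n q w w"
proof -
  have pu: "(\<Sum>k<n. p i k * u k) = w i" if "i < n" for i
  proof -
    have "(\<Sum>k<n. p i k * u k) = (\<Sum>j<n. (\<Sum>k<n. p i k * q k j) * w j)"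
      unfolding u_def sum_distrib_left sum_distrib_right by (subst sum.swap) (simp add: mult.assoc)
    then show ?thesis using that by (simp add: pq mult_delta_left)
  qed
  have "quad_form n p u u = (\<Sum>i<n. u i * (\<Sum>k<n. p i k * u k))"
    unfolding quad_form_def by (simp add: sum_distrib_left mult_ac)
  also have "\<dots> = (\<Sum>i<n. u i * w i)" by (simp add: pu)
  also have "\<dots> = (\<Sum>i<n. w i * u i)" by (simp add: mult.commute)
  also have "\<dots> = quad_form n q w w"
    unfolding quad_form_def u_def by (simp add: sum_distrib_left mult_ac)
  finally show ?thesis using coercive[of u] by simp
qed

lemma quad_form_inverse_nonneg: "0 \<le> quad_form n q w w"
  using order_trans[OF mult_nonneg_nonneg[OF less_imp_le[OF lam_pos] sum_nonneg] quad_form_inverse_ge]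
  by simp

text \<open>The form is the inner product of \<open>w\<close> with its image \<open>u\<close> under the inverse. Cauchy--Schwarz and the bound of
\<open>|u|^2\<close> by the form divided by \<open>lam\<close> give a quadratic inequality for the form.\<close>

lemma quad_form_inverse_le: "quad_form n q w w \<le> (\<Sum>i<n. (w i)\<^sup>2) / lam"
proof (cases "quad_form n q w w = 0")
  case True
  then show ?thesis using lam_pos by (simp add: sum_nonneg)
next
  case False
  let ?Q = "quad_form n q w w" and ?u = "\<lambda>i. \<Sum>j<n. q i j * w j"
  have pos: "?Q > 0" using False quad_form_inverse_nonneg[of w] by simp
  have "?Q = (\<Sum>i<n. w i * ?u i)" unfolding quad_form_def by (simp add: sum_distrib_left mult_ac)
  then have "?Q\<^sup>2 \<le> (\<Sum>i<n. (w i)\<^sup>2) * (\<Sum>i<n. (?u i)\<^sup>2)" by (simp only: Cauchy_Schwarz_ineq_sum)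
  also have "\<dots> \<le> (\<Sum>i<n. (w i)\<^sup>2) * (?Q / lam)"
    using quad_form_inverse_ge[of w] lam_pos
    by (intro mult_left_mono sum_nonneg) (auto simp: field_simps)
  finally have "?Q * ?Q \<le> ((\<Sum>i<n. (w i)\<^sup>2) / lam) * ?Q" by (simp add: power2_eq_square)
  then show ?thesis using pos by (simp only: mult_le_cancel_right_pos)
qed

text \<open>Positivity of the form at \<open>\<eta> * v + w\<close> and at \<open>\<eta> * v - w\<close>. The free weight \<open>\<eta>\<close> stands in for the
Cauchy--Schwarz inequality and keeps square roots of random variables out of the moment estimates.\<close>

lemma cross_term_le:
  assumes "\<eta> > 0"
  shows "2 * \<bar>quad_form n q v w\<bar> \<le> \<eta> * quad_form n q v v + quad_form n q w w / \<eta>"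
proof -
  have "0 \<le> \<eta>\<^sup>2 * quad_form n q v v + 2 * \<eta> * s * quad_form n q v w + s\<^sup>2 * quad_form n q w w" for s
    using quad_form_inverse_nonneg[of "\<lambda>i. \<eta> * v i + s * w i"]
    by (simp add: quad_form_lincomb[OF q_sym])
  from this[of 1] this[of "-1"]
  have "2 * \<eta> * \<bar>quad_form n q v w\<bar> \<le> \<eta>\<^sup>2 * quad_form n q v v + quad_form n q w w" by (simp add: abs_if)
  also have "\<dots> = \<eta> * (\<eta> * quad_form n q v v + quad_form n q w w / \<eta>)"
    using assms by (simp add: field_simps power2_eq_square)
  finally have "\<eta> * (2 * \<bar>quad_form n q v w\<bar>) \<le> \<eta> * (\<eta> * quad_form n q v v + quad_form n q w w / \<eta>)"
    by (simp add: mult_ac)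
  then show ?thesis using assms by simp
qed

text \<open>The deterministic part of the error analysis: only \<open>A\<close>, which has explicit moments, and \<open>D\<close>, which
is a plain sum of squares, appear in the bound.\<close>

lemma perturbed_quad_form_error:
  fixes b r :: "nat \<Rightarrow> real" and s :: real
  assumes \<eta>: "\<eta> > 0" and n: "n > 0"
  defines "A \<equiv> quad_form n q b b / real n" and "D \<equiv> (\<Sum>i<n. (r i)\<^sup>2) / (lam * real n)"
    and "F \<equiv> quad_form n q (\<lambda>i. s * b i + r i) (\<lambda>i. s * b i + r i) / real n"
  shows "(F - s\<^sup>2)\<^sup>2 \<le> 4 * (s ^ 4 * (A - 1)\<^sup>2 + s\<^sup>2 * \<eta>\<^sup>2 * A\<^sup>2 + s\<^sup>2 * D\<^sup>2 / \<eta>\<^sup>2 + D\<^sup>2)"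
proof -
  define C where "C = quad_form n q b r / real n"
  define D' where "D' = quad_form n q r r / real n"
  have F: "F = s\<^sup>2 * A + 2 * s * C + D'"
    using quad_form_lincomb[OF q_sym, where a = s and b = 1 and v = b and w = r and n = n]
    unfolding F_def A_def C_def D'_def by (simp add: add_divide_distrib)
  have D': "0 \<le> D'" "D' \<le> D"
    using quad_form_inverse_nonneg[of r] quad_form_inverse_le[of r] n lam_pos
    unfolding D'_def D_def by (auto simp: field_simps)
  have A: "0 \<le> A" using quad_form_inverse_nonneg[of b] by (simp add: A_def)
  have "2 * \<bar>C\<bar> \<le> \<eta> * A + D' / \<eta>"
    using divide_right_mono[OF cross_term_le[OF \<eta>, of b r], of "real n"] n
    unfolding C_def A_def D'_def by (simp add: add_divide_distrib abs_divide mult.commute)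
  also have "\<dots> \<le> \<eta> * A + D / \<eta>" using D' \<eta> by (simp add: divide_right_mono)
  finally have C: "\<bar>s\<bar> * (2 * \<bar>C\<bar>) \<le> \<bar>s\<bar> * (\<eta> * A + D / \<eta>)" by (intro mult_left_mono) auto
  let ?x = "s\<^sup>2 * \<bar>A - 1\<bar>" and ?y = "\<bar>s\<bar> * (\<eta> * A)" and ?z = "\<bar>s\<bar> * (D / \<eta>)"
  have "F - s\<^sup>2 = s\<^sup>2 * (A - 1) + 2 * s * C + D'" unfolding F by (simp add: algebra_simps)
  also have "\<bar>\<dots>\<bar> \<le> \<bar>s\<^sup>2 * (A - 1)\<bar> + \<bar>2 * s * C\<bar> + \<bar>D'\<bar>"
    by (intro order_trans[OF abs_triangle_ineq] add_mono abs_triangle_ineq order_refl)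
  also have "\<dots> \<le> ?x + ?y + ?z + D"
  proof -
    have "\<bar>s\<^sup>2 * (A - 1)\<bar> = ?x" "\<bar>2 * s * C\<bar> = \<bar>s\<bar> * (2 * \<bar>C\<bar>)" by (simp_all add: abs_mult)
    moreover have "\<bar>s\<bar> * (\<eta> * A + D / \<eta>) = ?y + ?z" by (rule distrib_left)
    ultimately show ?thesis using C D' by linarith
  qed
  finally have "\<bar>F - s\<^sup>2\<bar> \<le> ?x + ?y + ?z + D" .
  then have "(F - s\<^sup>2)\<^sup>2 \<le> (?x + ?y + ?z + D)\<^sup>2"
    by (metis abs_ge_zero power2_abs power_mono)
  also have "\<dots> \<le> 4 * (?x\<^sup>2 + ?y\<^sup>2 + ?z\<^sup>2 + D\<^sup>2)"
  proof -
    have "(x + y + z + d)\<^sup>2 \<le> 4 * (x\<^sup>2 + y\<^sup>2 + z\<^sup>2 + d\<^sup>2)" for x y z d :: real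
      using sum_squares_bound[of x y] sum_squares_bound[of x z] sum_squares_bound[of x d]
        sum_squares_bound[of y z] sum_squares_bound[of y d] sum_squares_bound[of z d]
      by (simp add: power2_eq_square algebra_simps)
    then show ?thesis .
  qed
  also have "\<dots> = 4 * (s ^ 4 * (A - 1)\<^sup>2 + s\<^sup>2 * \<eta>\<^sup>2 * A\<^sup>2 + s\<^sup>2 * D\<^sup>2 / \<eta>\<^sup>2 + D\<^sup>2)"
    by (simp add: power_mult_distrib power_divide)
  finally show ?thesis .
qed

end

section \<open>The estimator as a quadratic form\<close>

lemma fbm_cov_mat_entry:
  "i < n \<Longrightarrow> j < n \<Longrightarrow> fbm_cov_mat H \<delta> n $$ (i, j) = \<delta> powr (2 * H) * fgn_cov H (real i - real j)"
  by (simp add: fbm_cov_mat_def fgn_cov_def)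

lemma fgn_cov_minus: "fgn_cov H (- k) = fgn_cov H k"
  by (simp add: fgn_cov_def)

text \<open>A coercive matrix has trivial kernel, hence nonzero determinant, so \<open>mat_inverse\<close> yields a two-sided
inverse.\<close>

lemma estimator_coercive_inverse:
  fixes X :: "real \<Rightarrow> 'a \<Rightarrow> real"
  assumes \<delta>: "\<delta> > 0" and c: "c > 0"
    and coer: "\<And>v. c * (\<Sum>i<n. (v i)\<^sup>2) \<le> (\<Sum>i<n. \<Sum>j<n. v i * v j * fgn_cov H (real i - real j))"
  obtains q where
    "coercive_inverse n (\<lambda>i j. \<delta> powr (2 * H) * fgn_cov H (real i - real j)) q (c * \<delta> powr (2 * H))"
    "\<And>\<omega>. sigma2_estimator H \<delta> n X \<omega> =
       quad_form n q (\<lambda>i. X ((real i + 1) * \<delta>) \<omega> - X (real i * \<delta>) \<omega>)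
         (\<lambda>i. X ((real i + 1) * \<delta>) \<omega> - X (real i * \<delta>) \<omega>) / real n"
proof -
  let ?P = "fbm_cov_mat H \<delta> n"
  define p where "p = (\<lambda>i j. \<delta> powr (2 * H) * fgn_cov H (real i - real j))"
  let ?lam = "c * \<delta> powr (2 * H)"
  have lam: "?lam > 0" using c \<delta> by simp
  have P: "?P \<in> carrier_mat n n" by (simp add: fbm_cov_mat_def)
  have entry: "?P $$ (i, j) = p i j" if "i < n" "j < n" for i j
    using that by (simp add: fbm_cov_mat_entry p_def)
  have coercive: "?lam * (\<Sum>i<n. (v i)\<^sup>2) \<le> quad_form n p v v" for v
  proof -
    have "?lam * (\<Sum>i<n. (v i)\<^sup>2) = \<delta> powr (2 * H) * (c * (\<Sum>i<n. (v i)\<^sup>2))" by simp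
    also have "\<dots> \<le> \<delta> powr (2 * H) * (\<Sum>i<n. \<Sum>j<n. v i * v j * fgn_cov H (real i - real j))"
      by (intro mult_left_mono coer) simp
    also have "\<dots> = quad_form n p v v"
      unfolding quad_form_def p_def by (simp add: sum_distrib_left mult_ac)
    finally show ?thesis .
  qed
  have "Determinant.det ?P \<noteq> 0"
  proof
    assume "Determinant.det ?P = 0"
    then obtain v where v: "v \<in> carrier_vec n" "v \<noteq> 0\<^sub>v n" "?P *\<^sub>v v = 0\<^sub>v n"
      using det_0_iff_vec_prod_zero_field[OF P] by auto
    have "(\<Sum>j<n. p i j * v $ j) = 0" if "i < n" for i
    proof -
      have "(?P *\<^sub>v v) $ i = (\<Sum>j<n. ?P $$ (i, j) * v $ j)"
        using that P v(1) by (simp add: scalar_prod_def lessThan_atLeast0)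
      also have "\<dots> = (\<Sum>j<n. p i j * v $ j)" using that by (simp add: entry)
      finally show ?thesis using v(3) that by simp
    qed
    then have "quad_form n p (\<lambda>i. v $ i) (\<lambda>i. v $ i) = 0"
      unfolding quad_form_def
      by (simp add: mult.commute[of "p _ _"] mult.assoc sum_distrib_left[symmetric])
    then have "?lam * (\<Sum>i<n. (v $ i)\<^sup>2) \<le> 0" using coercive[of "\<lambda>i. v $ i"] by simp
    then have "?lam * (\<Sum>i<n. (v $ i)\<^sup>2) \<le> ?lam * 0" by simp
    then have "(\<Sum>i<n. (v $ i)\<^sup>2) \<le> 0" using lam by (simp only: mult_le_cancel_left_pos)
    then have "(\<Sum>i<n. (v $ i)\<^sup>2) = 0" by (intro antisym sum_nonneg) auto
    then have "v $ i = 0" if "i < n" for i using that by (simp add: sum_nonneg_eq_0_iff)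
    then have "v = 0\<^sub>v n" using v(1) by (intro eq_vecI) auto
    then show False using v(2) by simp
  qed
  then have "?P \<in> Units (ring_mat TYPE(real) n ())"
    by (rule det_non_zero_imp_unit[OF P])
  then obtain Q where Q: "mat_inverse ?P = Some Q"
    using mat_inverse(1)[OF P, where b = "()"] by (cases "mat_inverse ?P") auto
  then have inv: "?P * Q = 1\<^sub>m n" "Q * ?P = 1\<^sub>m n" and Qc: "Q \<in> carrier_mat n n"
    using mat_inverse(2)[OF P] by auto
  define q where "q = (\<lambda>i j. Q $$ (i, j))"
  have prod: "(A * C) $$ (i, k) = (\<Sum>j<n. A $$ (i, j) * C $$ (j, k))"
    if "A \<in> carrier_mat n n" "C \<in> carrier_mat n n" "i < n" "k < n" for A C :: "real Matrix.mat" and i k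
    using that by (simp add: scalar_prod_def lessThan_atLeast0)
  show thesis
  proof
    show "coercive_inverse n (\<lambda>i j. \<delta> powr (2 * H) * fgn_cov H (real i - real j)) q ?lam"
      unfolding p_def[symmetric]
    proof
      fix i k assume ik: "i < n" "k < n"
      show "(\<Sum>j<n. q i j * p j k) = (if i = k then 1 else 0)"
        using prod[OF Qc P ik] inv(2) ik by (simp add: q_def entry)
      show "(\<Sum>j<n. p i j * q j k) = (if i = k then 1 else 0)"
        using prod[OF P Qc ik] inv(1) ik by (simp add: q_def entry)
      show "p i k = p k i"
        unfolding p_def using fgn_cov_minus[of H "real i - real k"] by simp
    qed (rule lam coercive)+
    fix \<omega>
    let ?x = "\<lambda>i. X ((real i + 1) * \<delta>) \<omega> - X (real i * \<delta>) \<omega>"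
    have "scalar_prod (increments X \<delta> n \<omega>) (Q *\<^sub>v increments X \<delta> n \<omega>) =
        (\<Sum>i<n. ?x i * (\<Sum>j<n. q i j * ?x j))"
      using Qc by (simp add: increments_def scalar_prod_def lessThan_atLeast0 q_def)
    also have "\<dots> = quad_form n q ?x ?x"
      unfolding quad_form_def by (simp add: sum_distrib_left mult_ac)
    finally show "sigma2_estimator H \<delta> n X \<omega> = quad_form n q ?x ?x / real n"
      by (simp add: sigma2_estimator_def Q)
  qed
qed

section \<open>Riemann--Stieltjes sums and the Langevin equation\<close>

definition grid :: "real \<Rightarrow> real \<Rightarrow> nat \<Rightarrow> nat \<Rightarrow> real" where
  "grid a b n k = a + real k * (b - a) / real n"

lemma grid_0 [simp]: "grid a b n 0 = a"
  by (simp add: grid_def)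

lemma grid_n: "n > 0 \<Longrightarrow> grid a b n n = b"
  by (simp add: grid_def)

lemma grid_Suc: "grid a b n (Suc k) = grid a b n k + (b - a) / real n"
  by (simp add: grid_def add_divide_distrib distrib_right)

lemma grid_mono: "a \<le> b \<Longrightarrow> k \<le> l \<Longrightarrow> grid a b n k \<le> grid a b n l"
  by (simp add: grid_def divide_right_mono mult_right_mono)

lemma grid_strict_mono: "a < b \<Longrightarrow> n > 0 \<Longrightarrow> k < l \<Longrightarrow> grid a b n k < grid a b n l"
  by (simp add: grid_def divide_strict_right_mono)

lemma grid_mem: "a \<le> b \<Longrightarrow> n > 0 \<Longrightarrow> k \<le> n \<Longrightarrow> grid a b n k \<in> {a..b}"
  using grid_mono[of a b 0 k n] grid_mono[of a b k n n] by (simp add: grid_n)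

lemma grid_tagged_division:
  assumes "a < b" "n > 0"
  shows "(\<lambda>k. (grid a b n k, {grid a b n k..grid a b n (Suc k)})) ` {..<n} tagged_division_of {a..b}"
proof (rule tagged_division_ofI)
  let ?s = "grid a b n"
  note lt = grid_strict_mono[OF assms]
  show "finite ((\<lambda>k. (?s k, {?s k..?s (Suc k)})) ` {..<n})" by simp
  fix x K assume "(x, K) \<in> (\<lambda>k. (?s k, {?s k..?s (Suc k)})) ` {..<n}"
  then obtain k where k: "k < n" "x = ?s k" "K = {?s k..?s (Suc k)}" by auto
  show "x \<in> K" using lt[of k "Suc k"] k by auto
  show "K \<subseteq> {a..b}" using grid_mem[of a b n k] grid_mem[of a b n "Suc k"] assms k by auto
  show "\<exists>c d. K = cbox c d" using k by (auto simp: cbox_interval)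
  fix y L assume "(y, L) \<in> (\<lambda>k. (?s k, {?s k..?s (Suc k)})) ` {..<n}" and ne: "(x, K) \<noteq> (y, L)"
  then obtain l where l: "l < n" "y = ?s l" "L = {?s l..?s (Suc l)}" by auto
  have "k \<noteq> l" using ne k l by auto
  then consider "Suc k \<le> l" | "Suc l \<le> k" by linarith
  then show "interior K \<inter> interior L = {}"
    using grid_mono[of a b "Suc k" l n] grid_mono[of a b "Suc l" k n] assms
    unfolding k l by cases (auto simp: interior_atLeastAtMost_real)
next
  let ?s = "grid a b n"
  show "\<Union> {K. \<exists>x. (x, K) \<in> (\<lambda>k. (?s k, {?s k..?s (Suc k)})) ` {..<n}} = {a..b}"
  proof (intro equalityI subsetI)
    fix z assume "z \<in> \<Union> {K. \<exists>x. (x, K) \<in> (\<lambda>k. (?s k, {?s k..?s (Suc k)})) ` {..<n}}"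
    then obtain k where k: "k < n" "z \<in> {?s k..?s (Suc k)}" by auto
    then show "z \<in> {a..b}"
      using grid_mem[of a b n k] grid_mem[of a b n "Suc k"] assms by auto
  next
    fix z assume z: "z \<in> {a..b}"
    \<comment> \<open>Induction on the number of cells finds the one that contains \<open>z\<close>.\<close>
    have "\<exists>k<m. z \<in> {?s k..?s (Suc k)}" if "z \<le> ?s m" "0 < m" for m
      using that
    proof (induction m)
      case (Suc m)
      show ?case
      proof (cases "z \<le> ?s m \<and> 0 < m")
        case True then show ?thesis using Suc.IH by (auto intro: less_SucI)
      next
        case False
        then have "?s m \<le> z" using z by (cases "m = 0") auto
        then show ?thesis using Suc.prems by (intro exI[of _ m]) auto
      qed
    qed simp
    from this[of n] z assms obtain k where "k < n" "z \<in> {?s k..?s (Suc k)}" by (auto simp: grid_n)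
    then show "z \<in> \<Union> {K. \<exists>x. (x, K) \<in> (\<lambda>k. (?s k, {?s k..?s (Suc k)})) ` {..<n}}" by blast
  qed
qed

definition rs_sum :: "(real \<Rightarrow> real) \<Rightarrow> (real \<Rightarrow> real) \<Rightarrow> real \<Rightarrow> real \<Rightarrow> nat \<Rightarrow> real" where
  "rs_sum f g a b n = (\<Sum>k<n. f (grid a b n k) * (g (grid a b n (Suc k)) - g (grid a b n k)))"

text \<open>The Riemann--Stieltjes integral is a limit over tagged divisions of small mesh; evaluating it along
uniform grids with left tags turns it into the limit of a sequence, as needed for measurability
and Fatou's lemma.\<close>

lemma has_rs_integral_imp_rs_sum:
  assumes "has_rs_integral f g a b I" and ab: "a < b"
  shows "(\<lambda>n. rs_sum f g a b (Suc n)) \<longlonglongrightarrow> I"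
proof (rule LIMSEQ_I)
  fix r :: real assume "r > 0"
  then obtain d where d: "d > 0" and fine: "\<And>p. p tagged_division_of {a..b} \<Longrightarrow> (\<lambda>x. ball x d) fine p \<Longrightarrow>
        \<bar>(\<Sum>(x, K)\<in>p. f x * (g (Sup K) - g (Inf K))) - I\<bar> < r"
    using assms(1) unfolding has_rs_integral_def by meson
  obtain n0 where n0: "(b - a) / d < real n0" using reals_Archimedean2 by blast
  show "\<exists>no. \<forall>n\<ge>no. norm (rs_sum f g a b (Suc n) - I) < r"
  proof (intro exI[of _ n0] allI impI)
    fix n assume n: "n0 \<le> n"
    let ?s = "grid a b (Suc n)" and ?p = "\<lambda>k. (grid a b (Suc n) k, {grid a b (Suc n) k..grid a b (Suc n) (Suc k)})"
    have lt: "?s k < ?s l" if "k < l" for k l using grid_strict_mono[OF ab _ that] by simp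
    have "(b - a) / d < real (Suc n)" using n n0 by linarith
    then have mesh: "(b - a) / real (Suc n) < d" using d by (simp add: field_simps)
    have "(\<lambda>x. ball x d) fine ?p ` {..<Suc n}"
    proof (rule fineI)
      fix x K assume "(x, K) \<in> ?p ` {..<Suc n}"
      then obtain k where k: "x = ?s k" "K = {?s k..?s (Suc k)}" by auto
      show "K \<subseteq> ball x d" using mesh unfolding k grid_Suc by (auto simp: dist_real_def)
    qed
    from fine[OF grid_tagged_division[OF ab] this]
    have "\<bar>(\<Sum>(x, K)\<in>?p ` {..<Suc n}. f x * (g (Sup K) - g (Inf K))) - I\<bar> < r" by simp
    moreover have "inj_on ?p {..<Suc n}"
    proof (rule inj_onI)
      fix k l assume "?p k = ?p l"
      then have "?s k = ?s l" by simp
      then show "k = l" using lt[of k l] lt[of l k] by (cases k l rule: linorder_cases) auto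
    qed
    ultimately show "norm (rs_sum f g a b (Suc n) - I) < r"
      using lt[THEN less_imp_le] by (simp add: sum.reindex rs_sum_def del: sum.lessThan_Suc)
  qed
qed

text \<open>Summation by parts with the primitive of \<open>dg\<close> normalised to vanish at the right end. If \<open>f\<close> is
nonnegative and increasing, all weights are nonnegative, and they add up to \<open>f b\<close>.\<close>

lemma rs_sum_by_parts:
  assumes n: "n > 0"
  shows "rs_sum f g a b n = f a * (g b - g a)
    + (\<Sum>k<n. (f (grid a b n (Suc k)) - f (grid a b n k)) * (g b - g (grid a b n (Suc k))))"
proof -
  let ?f = "\<lambda>k. f (grid a b n k)" and ?g = "\<lambda>k. g (grid a b n k) - g b"
  have "(\<Sum>k<n. ?f (Suc k) * ?g (Suc k) - ?f k * ?g k) = ?f n * ?g n - ?f 0 * ?g 0"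
    by (rule sum_lessThan_telescope)
  then have "(\<Sum>k<n. ?f (Suc k) * ?g (Suc k) - ?f k * ?g k) = f a * (g b - g a)"
    using n by (simp add: grid_n algebra_simps)
  moreover have "(\<Sum>k<n. ?f (Suc k) * ?g (Suc k) - ?f k * ?g k)
    = rs_sum f g a b n - (\<Sum>k<n. (?f (Suc k) - ?f k) * (g b - g (grid a b n (Suc k))))"
    unfolding rs_sum_def sum_subtractf[symmetric] by (intro sum.cong refl) (simp add: algebra_simps)
  ultimately show ?thesis by simp
qed

text \<open>The sums on the right of \<open>rs_sum_by_parts\<close> are Riemann sums with respect to the measure with
density \<open>f\<close>. On each cell the error is at most the oscillation of \<open>h\<close> times the mass of the cell,
and \<open>h\<close> is uniformly continuous.\<close>

lemma weighted_riemann_sum_tendsto: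
  fixes F f h :: "real \<Rightarrow> real"
  assumes ab: "a < b" and h: "continuous_on {a..b} h" and f: "continuous_on {a..b} f"
    and F: "\<And>x. x \<in> {a..b} \<Longrightarrow> (F has_real_derivative f x) (at x within {a..b})"
    and nonneg: "\<And>x. x \<in> {a..b} \<Longrightarrow> 0 \<le> f x"
  shows "(\<lambda>n. \<Sum>k<Suc n. (F (grid a b (Suc n) (Suc k)) - F (grid a b (Suc n) k)) * h (grid a b (Suc n) (Suc k)))
     \<longlonglongrightarrow> integral {a..b} (\<lambda>x. f x * h x)"
proof (rule LIMSEQ_I)
  fix r :: real assume r: "r > 0"
  have intf: "(f has_integral F d - F c) {c..d}" if "a \<le> c" "c \<le> d" "d \<le> b" for c d
    using that by (intro fundamental_theorem_of_calculus)
      (auto intro!: DERIV_subset[OF F] simp flip: has_real_derivative_iff_has_vector_derivative)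
  have Fmono: "F c \<le> F d" if "a \<le> c" "c \<le> d" "d \<le> b" for c d
    using has_integral_nonneg[OF intf[OF that]] nonneg that by auto
  define e where "e = r / (2 * (F b - F a + 1))"
  have Fab: "F b - F a \<ge> 0" using Fmono[of a b] ab by simp
  have e: "e > 0" using r Fab by (simp add: e_def)
  have "uniformly_continuous_on {a..b} h" by (intro compact_uniformly_continuous h) simp
  then obtain d where d: "d > 0" "\<And>x y. x \<in> {a..b} \<Longrightarrow> y \<in> {a..b} \<Longrightarrow> dist y x < d \<Longrightarrow> dist (h y) (h x) < e"
    unfolding uniformly_continuous_on_def using e by meson
  obtain n0 where n0: "(b - a) / d < real n0" using reals_Archimedean2 by blast
  show "\<exists>no. \<forall>n\<ge>no. norm ((\<Sum>k<Suc n. (F (grid a b (Suc n) (Suc k)) - F (grid a b (Suc n) k)) * h (grid a b (Suc n) (Suc k)))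
      - integral {a..b} (\<lambda>x. f x * h x)) < r"
  proof (intro exI[of _ n0] allI impI)
    fix n assume n: "n0 \<le> n"
    let ?s = "grid a b (Suc n)"
    let ?J = "\<lambda>k. integral {?s k..?s (Suc k)} (\<lambda>x. f x * h x)"
    let ?R = "\<lambda>k. (F (?s (Suc k)) - F (?s k)) * h (?s (Suc k))"
    have "(b - a) / d < real (Suc n)" using n n0 by linarith
    then have mesh: "(b - a) / real (Suc n) < d" using d by (simp add: field_simps)
    have mem: "?s k \<in> {a..b}" if "k \<le> Suc n" for k using grid_mem[of a b "Suc n" k] ab that by simp
    have le: "?s k \<le> ?s (Suc k)" for k using grid_mono[of a b k "Suc k"] ab by simp
    have intfh: "(\<lambda>x. f x * h x) integrable_on {c..d}" if "a \<le> c" "d \<le> b" for c d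
      using that by (intro integrable_continuous_real continuous_intros continuous_on_subset[OF f] continuous_on_subset[OF h]) auto
    have piece: "\<bar>?R k - ?J k\<bar> \<le> e * (F (?s (Suc k)) - F (?s k))" if "k < Suc n" for k
    proof -
      have ak: "a \<le> ?s k" "?s (Suc k) \<le> b" using mem[of k] mem[of "Suc k"] that by auto
      have i1: "((\<lambda>x. f x * h (?s (Suc k))) has_integral ?R k) {?s k..?s (Suc k)}"
        by (intro has_integral_mult_left intf ak le)
      have i2: "((\<lambda>x. f x * h x) has_integral ?J k) {?s k..?s (Suc k)}"
        using intfh[OF ak] by (rule integrable_integral)
      have i3: "((\<lambda>x. f x * h (?s (Suc k)) - f x * h x) has_integral (?R k - ?J k)) {?s k..?s (Suc k)}"
        by (intro has_integral_diff i1 i2)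
      have i4: "((\<lambda>x. f x * e) has_integral (F (?s (Suc k)) - F (?s k)) * e) {?s k..?s (Suc k)}"
        by (intro has_integral_mult_left intf ak le)
      have "norm (?R k - ?J k) \<le> (F (?s (Suc k)) - F (?s k)) * e"
        unfolding integral_unique[OF i3, symmetric] integral_unique[OF i4, symmetric]
      proof (rule integral_norm_bound_integral)
        fix x assume x: "x \<in> {?s k..?s (Suc k)}"
        then have xab: "x \<in> {a..b}" using ak by auto
        have "dist (?s (Suc k)) x < d" using x mesh unfolding grid_Suc dist_real_def by auto
        then have "\<bar>h (?s (Suc k)) - h x\<bar> \<le> e"
          using d(2)[OF xab mem[of "Suc k"]] that by (simp add: dist_real_def)
        then have "f x * \<bar>h (?s (Suc k)) - h x\<bar> \<le> f x * e" by (intro mult_left_mono nonneg xab)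
        then show "norm (f x * h (?s (Suc k)) - f x * h x) \<le> f x * e"
          using nonneg[OF xab] by (simp add: right_diff_distrib[symmetric] abs_mult)
      qed (use i3 i4 in blast)+
      then show ?thesis by (simp add: mult.commute)
    qed
    have combine: "(\<Sum>k<m. ?J k) = integral {a..?s m} (\<lambda>x. f x * h x)" if "m \<le> Suc n" for m
      using that
    proof (induction m)
      case (Suc m)
      have "integral {a..?s m} (\<lambda>x. f x * h x) + ?J m = integral {a..?s (Suc m)} (\<lambda>x. f x * h x)"
        using mem[of m] mem[of "Suc m"] Suc.prems le[of m] intfh
        by (intro Henstock_Kurzweil_Integration.integral_combine) auto
      then show ?case using Suc by simp
    qed simp
    have diff: "(\<Sum>k<Suc n. ?R k) - integral {a..b} (\<lambda>x. f x * h x) = (\<Sum>k<Suc n. ?R k - ?J k)"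
    proof -
      have "?s (Suc n) = b" by (rule grid_n) simp
      then have "integral {a..b} (\<lambda>x. f x * h x) = (\<Sum>k<Suc n. ?J k)"
        using combine[of "Suc n"] by simp
      then show ?thesis by (simp only: sum_subtractf)
    qed
    have "\<bar>\<Sum>k<Suc n. ?R k - ?J k\<bar> \<le> (\<Sum>k<Suc n. \<bar>?R k - ?J k\<bar>)" by (rule sum_abs)
    also have "\<dots> \<le> (\<Sum>k<Suc n. e * (F (?s (Suc k)) - F (?s k)))" by (rule sum_mono, rule piece) (simp only: lessThan_iff)
    also have "\<dots> = e * (F b - F a)"
    proof -
      have "(\<Sum>k<Suc n. F (?s (Suc k)) - F (?s k)) = F (?s (Suc n)) - F (?s 0)"
        by (rule sum_lessThan_telescope)
      moreover have "?s (Suc n) = b" "?s 0 = a" by (rule grid_n, simp) simp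
      ultimately show ?thesis by (simp only: sum_distrib_left[symmetric])
    qed
    also have "\<dots> \<le> r / 2"
      unfolding e_def using Fab r by (simp add: field_simps)
    also have "\<dots> < r" using r by simp
    finally show "norm ((\<Sum>k<Suc n. ?R k) - integral {a..b} (\<lambda>x. f x * h x)) < r"
      unfolding diff real_norm_def .
  qed
qed

text \<open>Variation of constants for the integrated equation, where \<open>m\<close> is merely continuous: the
primitive \<open>V\<close> of \<open>y\<close> is differentiable, and \<open>exp (s / \<epsilon>) * V s\<close> has derivative
\<open>exp (s / \<epsilon>) * (y0 + m s)\<close>. Writing the noise through \<open>m t - m s\<close> gives exactly the limit of
the sums in \<open>rs_sum_by_parts\<close>.\<close>

lemma langevin_solution:
  fixes y m :: "real \<Rightarrow> real"
  assumes \<epsilon>: "\<epsilon> > 0" and y: "continuous_on {0..} y" and m: "continuous_on UNIV m" and t: "t \<ge> 0"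
    and eq: "\<And>t. t \<ge> 0 \<Longrightarrow> y t = y0 - 1 / \<epsilon> * integral {0..t} y + m t"
  shows "y t = exp (- t / \<epsilon>) * y0 + (exp (- t / \<epsilon>) * m t
    + integral {0..t} (\<lambda>s. exp (- (t - s) / \<epsilon>) / \<epsilon> * (m t - m s)))"
proof -
  define V where "V = (\<lambda>s. integral {0..s} y)"
  have V: "(V has_real_derivative y s) (at s within {0..t})" if "s \<in> {0..t}" for s
    unfolding V_def has_real_derivative_iff_has_vector_derivative
    using that by (intro integral_has_vector_derivative continuous_on_subset[OF y]) auto
  have i1: "((\<lambda>s. exp (s / \<epsilon>) * (y0 + m s)) has_integral exp (t / \<epsilon>) * V t - exp (0 / \<epsilon>) * V 0) {0..t}"
  proof (intro fundamental_theorem_of_calculus t)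
    fix s assume s: "s \<in> {0..t}"
    have "((\<lambda>s. exp (s / \<epsilon>) * V s) has_real_derivative
        exp (s / \<epsilon>) / \<epsilon> * V s + exp (s / \<epsilon>) * y s) (at s within {0..t})"
      using \<epsilon> by (auto intro!: derivative_eq_intros V[OF s])
    moreover have "exp (s / \<epsilon>) / \<epsilon> * V s + exp (s / \<epsilon>) * y s = exp (s / \<epsilon>) * (y0 + m s)"
    proof -
      have "y s + V s / \<epsilon> = y0 + m s" using eq[of s] s unfolding V_def by simp
      then show ?thesis by (simp flip: \<open>y s + V s / \<epsilon> = y0 + m s\<close> add: algebra_simps)
    qed
    ultimately show "((\<lambda>s. exp (s / \<epsilon>) * V s) has_vector_derivative exp (s / \<epsilon>) * (y0 + m s)) (at s within {0..t})"
      by (simp add: has_real_derivative_iff_has_vector_derivative)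
  qed
  have i2: "((\<lambda>s. exp (s / \<epsilon>) * (y0 + m t)) has_integral
      \<epsilon> * exp (t / \<epsilon>) * (y0 + m t) - \<epsilon> * exp (0 / \<epsilon>) * (y0 + m t)) {0..t}"
    using \<epsilon> by (intro fundamental_theorem_of_calculus t)
      (auto intro!: derivative_eq_intros simp flip: has_real_derivative_iff_has_vector_derivative)
  have i3: "((\<lambda>s. exp (- t / \<epsilon>) / \<epsilon> * (exp (s / \<epsilon>) * (y0 + m t) - exp (s / \<epsilon>) * (y0 + m s))) has_integral
      exp (- t / \<epsilon>) / \<epsilon> * (\<epsilon> * exp (t / \<epsilon>) * (y0 + m t) - \<epsilon> * exp (0 / \<epsilon>) * (y0 + m t)
        - (exp (t / \<epsilon>) * V t - exp (0 / \<epsilon>) * V 0))) {0..t}"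
    by (intro has_integral_mult_right has_integral_diff i1 i2)
  have e1: "exp (- t / \<epsilon>) / \<epsilon> * (exp (s / \<epsilon>) * (y0 + m t) - exp (s / \<epsilon>) * (y0 + m s))
      = exp (- (t - s) / \<epsilon>) / \<epsilon> * (m t - m s)" for s
  proof -
    have "exp (- (t - s) / \<epsilon>) = exp (- t / \<epsilon>) * exp (s / \<epsilon>)"
      by (simp add: exp_add[symmetric] diff_divide_distrib)
    then show ?thesis using \<epsilon> by (simp add: field_simps)
  qed
  have e2: "exp (- t / \<epsilon>) / \<epsilon> * (\<epsilon> * exp (t / \<epsilon>) * (y0 + m t) - \<epsilon> * exp (0 / \<epsilon>) * (y0 + m t)
        - (exp (t / \<epsilon>) * V t - exp (0 / \<epsilon>) * V 0)) = (1 - exp (- t / \<epsilon>)) * (y0 + m t) - V t / \<epsilon>"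
  proof -
    have "exp (- t / \<epsilon>) * exp (t / \<epsilon>) = 1" by (simp add: exp_add[symmetric])
    moreover have "V 0 = 0" by (simp add: V_def)
    ultimately show ?thesis using \<epsilon> by (simp add: exp_minus field_simps)
  qed
  have "integral {0..t} (\<lambda>s. exp (- (t - s) / \<epsilon>) / \<epsilon> * (m t - m s))
      = (1 - exp (- t / \<epsilon>)) * (y0 + m t) - V t / \<epsilon>"
    using i3 unfolding e1 e2 by (rule integral_unique)
  then show ?thesis using eq[OF t] unfolding V_def by (simp add: algebra_simps)
qed

lemma powr_le_exp_half:
  fixes u :: real
  assumes "0 < H" "H < 1" "0 \<le> u" shows "u powr (2 * H) \<le> 8 * exp (u / 2)"
proof -
  have "u powr (2 * H) \<le> 1 + u\<^sup>2"
  proof (cases "u \<le> 1")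
    case True
    have "u powr (2 * H) \<le> 1 powr (2 * H)" using assms True by (intro powr_mono2) auto
    then show ?thesis by (simp add: add_increasing2)
  next
    case False
    have "u powr (2 * H) \<le> u powr 2" using assms False by (intro powr_mono) auto
    then show ?thesis using False by (simp add: powr_numeral)
  qed
  also have "\<dots> \<le> 8 * (1 + u / 2 + (u / 2)\<^sup>2 / 2)" using assms by (simp add: power_divide)
  also have "\<dots> \<le> 8 * exp (u / 2)"
    using exp_lower_Taylor_quadratic[of "u / 2"] assms by (intro mult_left_mono) auto
  finally show ?thesis .
qed

text \<open>Put \<open>u = (b - s) / \<epsilon>\<close> and \<open>g = exp (- u / 2)\<close>, so that \<open>f = g\<^sup>2\<close> and \<open>u powr (2 * H) \<le> 8 / g\<close>. An
increment of \<open>g\<^sup>2\<close> divided by the larger value of \<open>g\<close> is at most twice the increment of \<open>g\<close>, so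
the sum is bounded by a telescoping one, uniformly in the interval and the mesh.\<close>

lemma exponential_weights_moment:
  assumes H: "0 < H" "H < 1" and \<epsilon>: "\<epsilon> > 0" and ab: "a \<le> b" and n: "n > 0"
  defines "f \<equiv> \<lambda>s. exp (- (b - s) / \<epsilon>)"
  shows "f a * (b - a) powr (2 * H) + (\<Sum>k<n. (f (grid a b n (Suc k)) - f (grid a b n k))
      * (b - grid a b n (Suc k)) powr (2 * H)) \<le> 16 * \<epsilon> powr (2 * H)"
proof -
  define g where "g = (\<lambda>s. exp (- ((b - s) / \<epsilon> / 2)))"
  have f: "f s = g s * g s" for s
    unfolding f_def g_def exp_add[symmetric] by (simp add: minus_divide_left)
  have g_pos: "0 < g s" for s by (simp add: g_def)
  have bd: "(b - s) powr (2 * H) \<le> \<epsilon> powr (2 * H) * (8 / g s)" if "s \<le> b" for s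
  proof -
    have "(b - s) powr (2 * H) = \<epsilon> powr (2 * H) * ((b - s) / \<epsilon>) powr (2 * H)"
      using \<epsilon> that by (simp add: powr_mult[symmetric])
    also have "\<dots> \<le> \<epsilon> powr (2 * H) * (8 * exp ((b - s) / \<epsilon> / 2))"
      using H \<epsilon> that by (intro mult_left_mono powr_le_exp_half) auto
    also have "8 * exp ((b - s) / \<epsilon> / 2) = 8 / g s" by (simp add: g_def exp_minus field_simps)
    finally show ?thesis .
  qed
  let ?s = "grid a b n" and ?E = "\<epsilon> powr (2 * H)"
  have step: "(f (?s (Suc k)) - f (?s k)) * (b - ?s (Suc k)) powr (2 * H)
      \<le> ?E * 16 * (g (?s (Suc k)) - g (?s k))" if "k < n" for k
  proof -
    have le: "?s k \<le> ?s (Suc k)" "?s (Suc k) \<le> b"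
      using grid_mono[OF ab, of k "Suc k" n] grid_mem[OF ab n, of "Suc k"] that by auto
    have gle: "g (?s k) \<le> g (?s (Suc k))" using le \<epsilon> by (simp add: g_def divide_right_mono)
    let ?x = "g (?s k)" and ?y = "g (?s (Suc k))"
    have "(?y * ?y - ?x * ?x) * (b - ?s (Suc k)) powr (2 * H) \<le> (?y * ?y - ?x * ?x) * (?E * (8 / ?y))"
      using gle g_pos less_imp_le[OF g_pos] by (intro mult_left_mono bd le) (auto intro!: mult_mono)
    also have "\<dots> = ?E * 8 * (?y - ?x) * ((?y + ?x) / ?y)"
      by (simp add: square_diff_square_factored)
    also have "\<dots> \<le> ?E * 8 * (?y - ?x) * 2"
      using gle g_pos[of "?s (Suc k)"] by (intro mult_left_mono mult_nonneg_nonneg) (auto simp: field_simps)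
    finally show ?thesis by (simp add: f)
  qed
  have "f a * (b - a) powr (2 * H) \<le> f a * (?E * (8 / g a))"
    by (intro mult_left_mono bd ab) (simp add: f_def)
  also have "\<dots> = ?E * 8 * g a" using g_pos[of a] by (simp add: f)
  also have "\<dots> \<le> ?E * 16 * g a" using g_pos[of a] by (intro mult_right_mono) auto
  finally have 0: "f a * (b - a) powr (2 * H) \<le> ?E * 16 * g a" .
  have "(\<Sum>k<n. (f (?s (Suc k)) - f (?s k)) * (b - ?s (Suc k)) powr (2 * H))
      \<le> (\<Sum>k<n. ?E * 16 * (g (?s (Suc k)) - g (?s k)))"
    by (intro sum_mono step) auto
  also have "\<dots> = ?E * 16 * (g b - g a)"
    unfolding sum_distrib_left[symmetric] sum_lessThan_telescope[of "\<lambda>k. g (?s k)"]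
    using n by (simp add: grid_n)
  also have "g b = 1" by (simp add: g_def)
  finally show ?thesis using 0 by (simp add: algebra_simps)
qed

section \<open>Moments of the stationary solution\<close>

locale fractional_brownian = prob_space M for M :: "'a measure" +
  fixes H :: real and B :: "real \<Rightarrow> 'a \<Rightarrow> real"
  assumes H: "0 < H" "H < 1" and fbm: "fractional_brownian_motion M H B"

sublocale fractional_brownian \<subseteq> centred_gaussian_process M B
  using fbm unfolding fractional_brownian_motion_def by unfold_locales auto

text \<open>Fatou's lemma, as an almost sure limit agrees almost everywhere with the lower limit.\<close>

lemma nn_integral_le_of_tendsto:
  fixes g :: "nat \<Rightarrow> 'a \<Rightarrow> ennreal"
  assumes [measurable]: "\<And>n. g n \<in> borel_measurable M"
    and le: "\<And>n. (\<integral>\<^sup>+\<omega>. g n \<omega> \<partial>M) \<le> C"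
    and lim: "AE \<omega> in M. (\<lambda>n. g n \<omega>) \<longlonglongrightarrow> h \<omega>"
  shows "(\<integral>\<^sup>+\<omega>. h \<omega> \<partial>M) \<le> C"
proof -
  have "(\<integral>\<^sup>+\<omega>. h \<omega> \<partial>M) = (\<integral>\<^sup>+\<omega>. liminf (\<lambda>n. g n \<omega>) \<partial>M)"
    using lim by (intro nn_integral_cong_AE) (auto elim!: eventually_mono simp: lim_imp_Liminf)
  also have "\<dots> \<le> liminf (\<lambda>n. \<integral>\<^sup>+\<omega>. g n \<omega> \<partial>M)" by (intro nn_integral_liminf) simp
  also have "\<dots> \<le> C" using le by (intro Liminf_le) (auto simp: always_eventually)
  finally show ?thesis .
qed

lemma nn_fourth_moment_add:
  assumes [measurable]: "Z \<in> borel_measurable M" "W \<in> borel_measurable M"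
    and Z: "(\<integral>\<^sup>+\<omega>. ennreal (Z \<omega> ^ 4) \<partial>M) \<le> ennreal a" and W: "(\<integral>\<^sup>+\<omega>. ennreal (W \<omega> ^ 4) \<partial>M) \<le> ennreal b"
    and ab: "0 \<le> a" "0 \<le> b"
  shows "(\<integral>\<^sup>+\<omega>. ennreal ((Z \<omega> + W \<omega>) ^ 4) \<partial>M) \<le> ennreal (8 * (a + b))"
proof -
  have "(\<integral>\<^sup>+\<omega>. ennreal ((Z \<omega> + W \<omega>) ^ 4) \<partial>M) \<le> (\<integral>\<^sup>+\<omega>. ennreal 8 * (ennreal (Z \<omega> ^ 4) + ennreal (W \<omega> ^ 4)) \<partial>M)"
  proof (intro nn_integral_mono)
    fix \<omega>
    have "ennreal 8 * (ennreal (Z \<omega> ^ 4) + ennreal (W \<omega> ^ 4)) = ennreal (8 * (Z \<omega> ^ 4 + W \<omega> ^ 4))"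
      by (subst ennreal_plus[symmetric], simp, simp, subst ennreal_mult[symmetric]) auto
    then show "ennreal ((Z \<omega> + W \<omega>) ^ 4) \<le> ennreal 8 * (ennreal (Z \<omega> ^ 4) + ennreal (W \<omega> ^ 4))"
      using power4_add_le by (simp only:) (intro ennreal_leI)
  qed
  also have "\<dots> = ennreal 8 * ((\<integral>\<^sup>+\<omega>. ennreal (Z \<omega> ^ 4) \<partial>M) + (\<integral>\<^sup>+\<omega>. ennreal (W \<omega> ^ 4) \<partial>M))"
    by (simp add: nn_integral_cmult nn_integral_add)
  also have "\<dots> \<le> ennreal 8 * (ennreal a + ennreal b)" by (intro mult_left_mono add_mono Z W) auto
  also have "\<dots> = ennreal (8 * (a + b))"
    using ab by (subst ennreal_plus[symmetric], simp, simp, subst ennreal_mult[symmetric]) auto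
  finally show ?thesis .
qed

lemma nn_fourth_moment_imp_L4:
  assumes [measurable]: "Z \<in> borel_measurable M"
    and Z: "(\<integral>\<^sup>+\<omega>. ennreal (Z \<omega> ^ 4) \<partial>M) \<le> ennreal a" and a: "0 \<le> a"
  shows "L4 M Z" and "(\<integral>\<omega>. Z \<omega> ^ 4 \<partial>M) \<le> a"
proof -
  have "(\<integral>\<^sup>+\<omega>. ennreal (norm (Z \<omega> ^ 4)) \<partial>M) < \<infinity>"
    using Z by (simp add: le_less_trans[OF _ ennreal_less_top])
  then have i: "integrable M (\<lambda>\<omega>. Z \<omega> ^ 4)" by (intro integrableI_bounded) auto
  then show "L4 M Z" by (simp add: L4_def)
  show "(\<integral>\<omega>. Z \<omega> ^ 4 \<partial>M) \<le> a"
    using Z nn_integral_eq_integral[OF i] a by (simp add: ennreal_le_iff)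
qed

text \<open>Jensen's inequality for the square and a finite probability vector.\<close>

lemma weighted_sum_square_le:
  fixes w d :: "nat \<Rightarrow> real"
  assumes w: "\<And>k. k < n \<Longrightarrow> 0 \<le> w k" and one: "(\<Sum>k<n. w k) = 1"
  shows "(\<Sum>k<n. w k * d k)\<^sup>2 \<le> (\<Sum>k<n. w k * (d k)\<^sup>2)"
proof -
  have "(\<Sum>k<n. w k * d k) = (\<Sum>k<n. sqrt (w k) * (sqrt (w k) * d k))"
    using w by (intro sum.cong refl) (simp add: mult.assoc[symmetric])
  then have "(\<Sum>k<n. w k * d k)\<^sup>2 \<le> (\<Sum>k<n. (sqrt (w k))\<^sup>2) * (\<Sum>k<n. (sqrt (w k) * d k)\<^sup>2)"
    by (simp only: Cauchy_Schwarz_ineq_sum)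
  also have "(\<Sum>k<n. (sqrt (w k))\<^sup>2) = (\<Sum>k<n. w k)"
    using w by (intro sum.cong refl) simp
  also have "(\<Sum>k<n. (sqrt (w k) * d k)\<^sup>2) = (\<Sum>k<n. w k * (d k)\<^sup>2)"
    using w by (intro sum.cong refl) (simp add: power_mult_distrib)
  finally show ?thesis using one by simp
qed

lemma
  assumes "kinetic_fbm M H \<sigma>1 \<sigma>2 x0 \<epsilon> B X Y"
  shows kinetic_fbm_measurable: "t \<ge> 0 \<Longrightarrow> X t \<in> borel_measurable M" "t \<ge> 0 \<Longrightarrow> Y t \<in> borel_measurable M"
    and kinetic_fbm_continuous: "AE \<omega> in M. continuous_on {0..} (\<lambda>t. Y t \<omega>)"
    and kinetic_fbm_initial: "AE \<omega> in M. \<exists>I. has_rs_integral_from_minf (\<lambda>s. exp (s / \<epsilon>)) (\<lambda>s. B s \<omega>) 0 I \<and>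
             Y 0 \<omega> = \<epsilon> powr (- H) * \<sigma>2 * I"
    and kinetic_fbm_velocity: "AE \<omega> in M. \<forall>t\<ge>0. Y t \<omega> = Y 0 \<omega> - 1 / \<epsilon> * integral {0..t} (\<lambda>s. Y s \<omega>)
                          + \<sigma>2 / \<epsilon> powr H * (B t \<omega> - B 0 \<omega>)"
    and kinetic_fbm_position: "AE \<omega> in M. \<forall>t\<ge>0. X t \<omega> = x0 + integral {0..t} (\<lambda>s. \<sigma>1 * \<epsilon> powr (H - 1) * Y s \<omega>)"
  using assms unfolding kinetic_fbm_def AE_conj_iff by blast+

context fractional_brownian
begin

lemma covariance:
  "(\<integral>\<omega>. B t \<omega> * B s \<omega> \<partial>M) = (\<bar>t\<bar> powr (2 * H) + \<bar>s\<bar> powr (2 * H) - \<bar>t - s\<bar> powr (2 * H)) / 2"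
  using fbm unfolding fractional_brownian_motion_def by blast

lemma B_measurable [measurable]: "B t \<in> borel_measurable M"
  using base_L4 by (rule L4_measurable)

lemma increment_span: "(\<lambda>\<omega>. B t \<omega> - B s \<omega>) \<in> lin_span B"
  by (intro lin_span_diff lin_span_base)

lemma increment_covariance:
  "(\<integral>\<omega>. (B t \<omega> - B s \<omega>) * (B v \<omega> - B u \<omega>) \<partial>M)
    = (\<bar>t - u\<bar> powr (2 * H) + \<bar>s - v\<bar> powr (2 * H) - \<bar>t - v\<bar> powr (2 * H) - \<bar>s - u\<bar> powr (2 * H)) / 2"
proof -
  have i: "integrable M (\<lambda>\<omega>. B t \<omega> * B s \<omega>)" for t s by (intro L4_prod2 base_L4)
  have "(\<integral>\<omega>. (B t \<omega> - B s \<omega>) * (B v \<omega> - B u \<omega>) \<partial>M)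
    = (\<integral>\<omega>. B t \<omega> * B v \<omega> - B t \<omega> * B u \<omega> - B s \<omega> * B v \<omega> + B s \<omega> * B u \<omega> \<partial>M)"
    by (simp add: algebra_simps)
  also have "\<dots> = (\<bar>t - u\<bar> powr (2 * H) + \<bar>s - v\<bar> powr (2 * H) - \<bar>t - v\<bar> powr (2 * H) - \<bar>s - u\<bar> powr (2 * H)) / 2"
    using i by (simp add: covariance field_simps)
  finally show ?thesis .
qed

lemma increment_variance: "(\<integral>\<omega>. (B t \<omega> - B s \<omega>)\<^sup>2 \<partial>M) = \<bar>t - s\<bar> powr (2 * H)"
  unfolding power2_eq_square increment_covariance by (simp add: abs_minus_commute)

lemma noise_covariance:
  assumes \<delta>: "\<delta> > 0"
  shows "(\<integral>\<omega>. (B ((real i + 1) * \<delta>) \<omega> - B (real i * \<delta>) \<omega>) * (B ((real j + 1) * \<delta>) \<omega> - B (real j * \<delta>) \<omega>) \<partial>M)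
    = \<delta> powr (2 * H) * fgn_cov H (real i - real j)"
proof -
  define k where "k = real i - real j"
  have s: "\<bar>x * \<delta>\<bar> powr (2 * H) = \<delta> powr (2 * H) * \<bar>x\<bar> powr (2 * H)" for x
    using \<delta> by (simp add: abs_mult powr_mult mult.commute)
  have d: "(real i + 1) * \<delta> - real j * \<delta> = (k + 1) * \<delta>" "real i * \<delta> - (real j + 1) * \<delta> = (k - 1) * \<delta>"
    "(real i + 1) * \<delta> - (real j + 1) * \<delta> = k * \<delta>" "real i * \<delta> - real j * \<delta> = k * \<delta>"
    by (simp_all add: k_def algebra_simps)
  have "\<bar>k + 1\<bar> powr (2 * H) + \<bar>k - 1\<bar> powr (2 * H) = (\<bar>k\<bar> + 1) powr (2 * H) + \<bar>\<bar>k\<bar> - 1\<bar> powr (2 * H)"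
  proof (cases "0 \<le> k")
    case False
    then have "\<bar>k - 1\<bar> = \<bar>k\<bar> + 1" "\<bar>k + 1\<bar> = \<bar>\<bar>k\<bar> - 1\<bar>" by linarith+
    then show ?thesis by simp
  qed simp
  then have e: "(\<bar>k\<bar> + 1) powr (2 * H) + \<bar>\<bar>k\<bar> - 1\<bar> powr (2 * H) = \<bar>k + 1\<bar> powr (2 * H) + \<bar>k - 1\<bar> powr (2 * H)" ..
  show ?thesis
    unfolding increment_covariance d s k_def[symmetric] fgn_cov_def e
    by (simp add: algebra_simps)
qed

text \<open>After summation by parts the sum is an average of the increments \<open>B b - B s\<close> with nonnegative
weights of total mass \<open>f b = 1\<close>. Jensen's inequality bounds its variance by the same
average of \<open>(b - s) powr (2 * H)\<close>; the fourth moment follows since the sum is Gaussian, with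
\<open>768 = 3 * 16\<^sup>2\<close>.\<close>

lemma exponential_rs_sum_moments:
  assumes \<epsilon>: "\<epsilon> > 0" and ab: "a \<le> b" and n: "n > 0"
  defines "Z \<equiv> \<lambda>\<omega>. rs_sum (\<lambda>s. exp (- (b - s) / \<epsilon>)) (\<lambda>s. B s \<omega>) a b n"
  shows "Z \<in> lin_span B" and "(\<integral>\<omega>. Z \<omega> ^ 4 \<partial>M) \<le> 768 * \<epsilon> powr (4 * H)"
proof -
  let ?s = "grid a b n"
  define f where "f = (\<lambda>s. exp (- (b - s) / \<epsilon>))"
  define w where "w k = (if k = 0 then f a else f (?s k) - f (?s (k - 1)))" for k
  have Z: "Z \<omega> = (\<Sum>k<Suc n. w k * (B b \<omega> - B (?s k) \<omega>))" for \<omega>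
    unfolding Z_def rs_sum_by_parts[OF n] sum.lessThan_Suc_shift by (simp add: w_def f_def)
  show span: "Z \<in> lin_span B"
    unfolding Z by (intro lin_span_sum lin_span_scale increment_span)
  have w: "0 \<le> w k" for k
    using grid_mono[OF ab, of "k - 1" k n] \<epsilon> by (simp add: w_def f_def divide_right_mono)
  have one: "(\<Sum>k<Suc n. w k) = 1"
    unfolding sum.lessThan_Suc_shift using sum_lessThan_telescope[of "\<lambda>k. f (?s k)" n] n
    by (simp add: w_def grid_n) (simp add: f_def)
  have i: "integrable M (\<lambda>\<omega>. (B t \<omega> - B s \<omega>)\<^sup>2)" for t s
    unfolding power2_eq_square by (intro L4_prod2 span_L4 increment_span)
  have "(\<integral>\<omega>. (Z \<omega>)\<^sup>2 \<partial>M) \<le> (\<integral>\<omega>. (\<Sum>k<Suc n. w k * (B b \<omega> - B (?s k) \<omega>)\<^sup>2) \<partial>M)"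
  proof (rule integral_mono)
    show "integrable M (\<lambda>\<omega>. (Z \<omega>)\<^sup>2)"
      unfolding power2_eq_square by (intro L4_prod2 span_L4 span)
    show "integrable M (\<lambda>\<omega>. \<Sum>k<Suc n. w k * (B b \<omega> - B (?s k) \<omega>)\<^sup>2)"
      by (intro Bochner_Integration.integrable_sum integrable_mult_right i)
    show "(Z \<omega>)\<^sup>2 \<le> (\<Sum>k<Suc n. w k * (B b \<omega> - B (?s k) \<omega>)\<^sup>2)" for \<omega>
      unfolding Z by (rule weighted_sum_square_le[OF w one])
  qed
  also have "\<dots> = (\<Sum>k<Suc n. w k * \<bar>b - ?s k\<bar> powr (2 * H))"
    by (simp add: i increment_variance del: sum.lessThan_Suc)
  also have "\<dots> = f a * (b - a) powr (2 * H) + (\<Sum>k<n. (f (?s (Suc k)) - f (?s k)) * (b - ?s (Suc k)) powr (2 * H))"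
    unfolding sum.lessThan_Suc_shift using ab grid_mem[OF ab n] by (simp add: w_def)
  also have "\<dots> \<le> 16 * \<epsilon> powr (2 * H)"
    unfolding f_def by (rule exponential_weights_moment[OF H \<epsilon> ab n])
  finally have "(\<integral>\<omega>. (Z \<omega>)\<^sup>2 \<partial>M)\<^sup>2 \<le> (16 * \<epsilon> powr (2 * H))\<^sup>2"
    by (intro power_mono) auto
  also have "\<dots> = 256 * \<epsilon> powr (4 * H)"
    using \<epsilon> by (simp add: power_mult_distrib powr_power)
  finally show "(\<integral>\<omega>. Z \<omega> ^ 4 \<partial>M) \<le> 768 * \<epsilon> powr (4 * H)"
    unfolding span_fourth_moment[OF span] by simp
qed

lemma scaled_exponential_rs_sum_bound:
  fixes \<sigma> :: real
  assumes \<epsilon>: "\<epsilon> > 0" and ab: "a \<le> b"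
  defines "Z \<equiv> \<lambda>n \<omega>. \<epsilon> powr (- H) * \<sigma> * rs_sum (\<lambda>s. exp (- (b - s) / \<epsilon>)) (\<lambda>s. B s \<omega>) a b (Suc n)"
  shows "Z n \<in> borel_measurable M" and "(\<integral>\<^sup>+\<omega>. ennreal (Z n \<omega> ^ 4) \<partial>M) \<le> ennreal (768 * \<sigma> ^ 4)"
proof -
  note m = exponential_rs_sum_moments[OF \<epsilon> ab, of "Suc n", OF zero_less_Suc]
  have L: "L4 M (Z n)" unfolding Z_def by (intro L4_scale span_L4 m(1))
  then show "Z n \<in> borel_measurable M" by (rule L4_measurable)
  have c: "(\<epsilon> powr (- H) * \<sigma>) ^ 4 = \<epsilon> powr (- (4 * H)) * \<sigma> ^ 4"
    using \<epsilon> by (simp add: power_mult_distrib powr_power)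
  have "(\<integral>\<omega>. Z n \<omega> ^ 4 \<partial>M) = \<epsilon> powr (- (4 * H)) * \<sigma> ^ 4 *
      (\<integral>\<omega>. rs_sum (\<lambda>s. exp (- (b - s) / \<epsilon>)) (\<lambda>s. B s \<omega>) a b (Suc n) ^ 4 \<partial>M)"
    unfolding Z_def power_mult_distrib[of "\<epsilon> powr (- H) * \<sigma>"] c by simp
  also have "\<dots> \<le> \<epsilon> powr (- (4 * H)) * \<sigma> ^ 4 * (768 * \<epsilon> powr (4 * H))"
    by (intro mult_left_mono m(2)) auto
  also have "\<dots> = 768 * \<sigma> ^ 4" using \<epsilon> by (simp add: powr_minus)
  finally show "(\<integral>\<^sup>+\<omega>. ennreal (Z n \<omega> ^ 4) \<partial>M) \<le> ennreal (768 * \<sigma> ^ 4)"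
    using L by (subst nn_integral_eq_integral) (auto simp: L4_def intro!: ennreal_leI)
qed

text \<open>The initial value is a double limit, first of the mesh and then of the left end point. Its inner limits
\<open>J a\<close> are chosen separately for each \<open>\<omega>\<close> and need not be measurable in \<open>\<omega>\<close>, so the lower
limit \<open>G\<close> replaces their fourth powers before Fatou's lemma is applied a second time.\<close>

lemma initial_value_fourth_moment:
  assumes \<epsilon>: "\<epsilon> > 0" and kin: "kinetic_fbm M H \<sigma>1 \<sigma>2 x0 \<epsilon> B X Y"
  shows "(\<integral>\<^sup>+\<omega>. ennreal (Y 0 \<omega> ^ 4) \<partial>M) \<le> ennreal (768 * \<sigma>2 ^ 4)"
proof -
  define W where "W m n \<omega> = \<epsilon> powr (- H) * \<sigma>2 *
    rs_sum (\<lambda>s. exp (- (0 - s) / \<epsilon>)) (\<lambda>s. B s \<omega>) (- real (Suc m)) 0 (Suc n)" for m n \<omega>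
  have W [measurable]: "W m n \<in> borel_measurable M"
    and bound: "(\<integral>\<^sup>+\<omega>. ennreal (W m n \<omega> ^ 4) \<partial>M) \<le> ennreal (768 * \<sigma>2 ^ 4)" for m n
    unfolding W_def[abs_def] by (intro scaled_exponential_rs_sum_bound \<epsilon>; simp)+
  define G where "G m \<omega> = liminf (\<lambda>n. ennreal (W m n \<omega> ^ 4))" for m \<omega>
  have [measurable]: "G m \<in> borel_measurable M" for m unfolding G_def by measurable
  show ?thesis
  proof (rule nn_integral_le_of_tendsto[where g = G])
    fix m
    have "(\<integral>\<^sup>+\<omega>. G m \<omega> \<partial>M) \<le> liminf (\<lambda>n. \<integral>\<^sup>+\<omega>. ennreal (W m n \<omega> ^ 4) \<partial>M)"
      unfolding G_def by (intro nn_integral_liminf) simp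
    also have "\<dots> \<le> ennreal (768 * \<sigma>2 ^ 4)"
      using bound by (intro Liminf_le) (auto simp: always_eventually)
    finally show "(\<integral>\<^sup>+\<omega>. G m \<omega> \<partial>M) \<le> ennreal (768 * \<sigma>2 ^ 4)" .
  next
    show "AE \<omega> in M. (\<lambda>m. G m \<omega>) \<longlonglongrightarrow> ennreal (Y 0 \<omega> ^ 4)"
      using kinetic_fbm_initial[OF kin]
    proof eventually_elim
      case (elim \<omega>)
      then obtain I J where J: "\<And>a. a < 0 \<Longrightarrow> has_rs_integral (\<lambda>s. exp (s / \<epsilon>)) (\<lambda>s. B s \<omega>) a 0 (J a)"
        and I: "(J \<longlongrightarrow> I) at_bot" and Y0: "Y 0 \<omega> = \<epsilon> powr (- H) * \<sigma>2 * I"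
        unfolding has_rs_integral_from_minf_def by blast
      have G: "G m \<omega> = ennreal ((\<epsilon> powr (- H) * \<sigma>2 * J (- real (Suc m))) ^ 4)" for m
      proof -
        have "(\<lambda>n. W m n \<omega>) \<longlonglongrightarrow> \<epsilon> powr (- H) * \<sigma>2 * J (- real (Suc m))"
          unfolding W_def using has_rs_integral_imp_rs_sum[OF J[of "- real (Suc m)"]]
          by (intro tendsto_mult[OF tendsto_const]) simp
        then have "(\<lambda>n. ennreal (W m n \<omega> ^ 4)) \<longlonglongrightarrow> ennreal ((\<epsilon> powr (- H) * \<sigma>2 * J (- real (Suc m))) ^ 4)"
          by (intro tendsto_ennrealI tendsto_power)
        then show ?thesis unfolding G_def by (intro lim_imp_Liminf) auto
      qed
      have "filterlim (\<lambda>m. - real (Suc m)) at_bot sequentially"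
        unfolding filterlim_uminus_at_bot minus_minus
        by (rule filterlim_compose[OF filterlim_real_sequentially filterlim_Suc])
      then have J_lim: "(\<lambda>m. J (- real (Suc m))) \<longlonglongrightarrow> I" by (rule filterlim_compose[OF I])
      show ?case unfolding Y0 G
        by (rule tendsto_ennrealI[OF tendsto_power[OF tendsto_mult[OF tendsto_const J_lim]]])
    qed
  qed simp
qed

text \<open>By \<open>langevin_solution\<close>, \<open>Y t\<close> is the damped initial value plus a limit of Riemann--Stieltjes sums over
\<open>[0, t]\<close> of the kind that approximates \<open>Y 0\<close>, so both parts obey the same bound, and
\<open>(x + y)^4 \<le> 8 * (x^4 + y^4)\<close> combines them.\<close>

lemma stationary_fourth_moment:
  assumes \<epsilon>: "\<epsilon> > 0" and kin: "kinetic_fbm M H \<sigma>1 \<sigma>2 x0 \<epsilon> B X Y" and t: "t \<ge> 0"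
  shows "(\<integral>\<^sup>+\<omega>. ennreal (Y t \<omega> ^ 4) \<partial>M) \<le> ennreal (16 * 768 * \<sigma>2 ^ 4)"
proof (cases "t = 0")
  case True
  show ?thesis unfolding True
    by (rule order_trans[OF initial_value_fourth_moment[OF \<epsilon> kin]]) (simp add: ennreal_leI)
next
  case False
  then have t0: "0 < t" using t by simp
  have [measurable]: "Y t \<in> borel_measurable M" "Y 0 \<in> borel_measurable M"
    using kinetic_fbm_measurable[OF kin] t by auto
  define c where "c = \<epsilon> powr (- H) * \<sigma>2"
  define f where "f s = exp (- (t - s) / \<epsilon>)" for s
  define W where "W n \<omega> = c * rs_sum f (\<lambda>s. B s \<omega>) 0 t (Suc n)" for n \<omega>
  define e where "e = exp (- t / \<epsilon>)"
  have W_eq: "W = (\<lambda>n \<omega>. \<epsilon> powr (- H) * \<sigma>2 * rs_sum (\<lambda>s. exp (- (t - s) / \<epsilon>)) (\<lambda>s. B s \<omega>) 0 t (Suc n))"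
    unfolding W_def[abs_def] c_def f_def[abs_def] ..
  have W: "W n \<in> borel_measurable M" "(\<integral>\<^sup>+\<omega>. ennreal (W n \<omega> ^ 4) \<partial>M) \<le> ennreal (768 * \<sigma>2 ^ 4)" for n
    unfolding W_eq by (rule scaled_exponential_rs_sum_bound[OF \<epsilon> t])+
  have "AE \<omega> in M. continuous_on UNIV (\<lambda>t. B t \<omega>)"
    using fbm unfolding fractional_brownian_motion_def by blast
  with kinetic_fbm_continuous[OF kin] kinetic_fbm_velocity[OF kin]
  have "AE \<omega> in M. (\<lambda>n. W n \<omega>) \<longlonglongrightarrow> Y t \<omega> - e * Y 0 \<omega>"
  proof eventually_elim
    case (elim \<omega>)
    have cc: "\<sigma>2 / \<epsilon> powr H = c" by (simp add: c_def powr_minus field_simps)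
    have sol: "Y t \<omega> = e * Y 0 \<omega> + (e * (c * (B t \<omega> - B 0 \<omega>))
        + integral {0..t} (\<lambda>s. f s / \<epsilon> * (c * (B t \<omega> - B 0 \<omega>) - c * (B s \<omega> - B 0 \<omega>))))"
      unfolding e_def f_def
    proof (rule langevin_solution[OF \<epsilon>])
      show "continuous_on UNIV (\<lambda>s. c * (B s \<omega> - B 0 \<omega>))"
        by (intro continuous_intros elim(3))
      show "Y s \<omega> = Y 0 \<omega> - 1 / \<epsilon> * integral {0..s} (\<lambda>s. Y s \<omega>) + c * (B s \<omega> - B 0 \<omega>)" if "0 \<le> s" for s
        using elim(2) that unfolding cc by blast
    qed (rule elim(1), rule t)
    also have "integral {0..t} (\<lambda>s. f s / \<epsilon> * (c * (B t \<omega> - B 0 \<omega>) - c * (B s \<omega> - B 0 \<omega>)))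
        = c * integral {0..t} (\<lambda>s. f s / \<epsilon> * (B t \<omega> - B s \<omega>))"
    proof -
      have "f s / \<epsilon> * (c * (B t \<omega> - B 0 \<omega>) - c * (B s \<omega> - B 0 \<omega>)) = c * (f s / \<epsilon> * (B t \<omega> - B s \<omega>))" for s
        by (simp add: algebra_simps)
      then show ?thesis by (simp only: integral_mult_right)
    qed
    finally have Yt: "Y t \<omega> - e * Y 0 \<omega> = c * (f 0 * (B t \<omega> - B 0 \<omega>) + integral {0..t} (\<lambda>s. f s / \<epsilon> * (B t \<omega> - B s \<omega>)))"
      by (simp add: algebra_simps e_def f_def)
    have "(\<lambda>n. \<Sum>k<Suc n. (f (grid 0 t (Suc n) (Suc k)) - f (grid 0 t (Suc n) k)) * (B t \<omega> - B (grid 0 t (Suc n) (Suc k)) \<omega>))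
        \<longlonglongrightarrow> integral {0..t} (\<lambda>s. f s / \<epsilon> * (B t \<omega> - B s \<omega>))"
    proof (rule weighted_riemann_sum_tendsto[OF t0])
      show "continuous_on {0..t} (\<lambda>s. B t \<omega> - B s \<omega>)"
        by (intro continuous_intros continuous_on_subset[OF elim(3)]) auto
      show "continuous_on {0..t} (\<lambda>s. f s / \<epsilon>)" unfolding f_def using \<epsilon> by (intro continuous_intros) auto
      show "(f has_real_derivative f x / \<epsilon>) (at x within {0..t})" for x
        unfolding f_def[abs_def] using \<epsilon> by (auto intro!: derivative_eq_intros)
      show "0 \<le> f x / \<epsilon>" for x using \<epsilon> by (simp add: f_def)
    qed
    from tendsto_mult[OF tendsto_const tendsto_add[OF tendsto_const this]] show ?case
      unfolding W_def Yt rs_sum_by_parts[OF zero_less_Suc] .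
  qed
  then have "AE \<omega> in M. (\<lambda>n. ennreal (W n \<omega> ^ 4)) \<longlonglongrightarrow> ennreal ((Y t \<omega> - e * Y 0 \<omega>) ^ 4)"
    by (auto elim!: eventually_mono intro!: tendsto_ennrealI tendsto_power)
  then have Z: "(\<integral>\<^sup>+\<omega>. ennreal ((Y t \<omega> - e * Y 0 \<omega>) ^ 4) \<partial>M) \<le> ennreal (768 * \<sigma>2 ^ 4)"
    by (intro nn_integral_le_of_tendsto[OF _ W(2)]) (use W(1) in measurable)
  have e: "0 \<le> e" "e \<le> 1" using t \<epsilon> by (auto simp: e_def divide_nonneg_pos)
  have Y0: "(\<integral>\<^sup>+\<omega>. ennreal ((e * Y 0 \<omega>) ^ 4) \<partial>M) \<le> ennreal (768 * \<sigma>2 ^ 4)"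
  proof (rule order_trans[OF nn_integral_mono initial_value_fourth_moment[OF \<epsilon> kin]])
    fix \<omega>
    have "e ^ 4 * Y 0 \<omega> ^ 4 \<le> 1 * Y 0 \<omega> ^ 4" using e by (intro mult_right_mono power_le_one) auto
    then show "ennreal ((e * Y 0 \<omega>) ^ 4) \<le> ennreal (Y 0 \<omega> ^ 4)"
      by (intro ennreal_leI) (simp add: power_mult_distrib)
  qed
  show ?thesis using nn_fourth_moment_add[OF _ _ Z Y0] by (simp add: mult_ac)
qed

text \<open>The constant is \<open>8 * (2 * 16 * 768)\<close> rounded up to a square, so that its root is available
explicitly below.\<close>

lemma increment_fourth_moment:
  assumes \<epsilon>: "\<epsilon> > 0" and kin: "kinetic_fbm M H \<sigma>1 \<sigma>2 x0 \<epsilon> B X Y" and ts: "t \<ge> 0" "s \<ge> 0"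
  shows "L4 M (\<lambda>\<omega>. Y t \<omega> - Y s \<omega>)" and "(\<integral>\<omega>. (Y t \<omega> - Y s \<omega>) ^ 4 \<partial>M) \<le> 512\<^sup>2 * \<sigma>2 ^ 4"
proof -
  have [measurable]: "Y t \<in> borel_measurable M" "Y s \<in> borel_measurable M"
    using kinetic_fbm_measurable[OF kin] ts by auto
  have s: "(\<integral>\<^sup>+\<omega>. ennreal ((- Y s \<omega>) ^ 4) \<partial>M) \<le> ennreal (16 * 768 * \<sigma>2 ^ 4)"
    using stationary_fourth_moment[OF \<epsilon> kin ts(2)] by simp
  have "(\<integral>\<^sup>+\<omega>. ennreal ((Y t \<omega> - Y s \<omega>) ^ 4) \<partial>M) \<le> ennreal (512\<^sup>2 * \<sigma>2 ^ 4)"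
  proof -
    have "(\<integral>\<^sup>+\<omega>. ennreal ((Y t \<omega> + - Y s \<omega>) ^ 4) \<partial>M)
        \<le> ennreal (8 * (16 * 768 * \<sigma>2 ^ 4 + 16 * 768 * \<sigma>2 ^ 4))"
      by (intro nn_fourth_moment_add stationary_fourth_moment[OF \<epsilon> kin ts(1)] s) auto
    also have "\<dots> \<le> ennreal (512\<^sup>2 * \<sigma>2 ^ 4)"
      by (intro ennreal_leI) simp
    finally show ?thesis by simp
  qed
  from nn_fourth_moment_imp_L4[OF _ this]
  show "L4 M (\<lambda>\<omega>. Y t \<omega> - Y s \<omega>)" and "(\<integral>\<omega>. (Y t \<omega> - Y s \<omega>) ^ 4 \<partial>M) \<le> 512\<^sup>2 * \<sigma>2 ^ 4" by auto
qed

text \<open>The velocity equation expresses the time integral of \<open>Y\<close> through \<open>Y 0 - Y t\<close> and the noise; the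
factor \<open>\<epsilon> powr (H - 1)\<close> of the position equation makes the coefficient of the noise independent
of \<open>\<epsilon>\<close>.\<close>

lemma position_increment:
  assumes \<epsilon>: "\<epsilon> > 0" and kin: "kinetic_fbm M H \<sigma>1 \<sigma>2 x0 \<epsilon> B X Y"
  shows "AE \<omega> in M. \<forall>t\<ge>0. \<forall>s\<ge>0. X t \<omega> - X s \<omega> =
    \<sigma>1 * \<sigma>2 * (B t \<omega> - B s \<omega>) + (- \<sigma>1 * \<epsilon> powr H) * (Y t \<omega> - Y s \<omega>)"
proof -
  show ?thesis using kinetic_fbm_velocity[OF kin] kinetic_fbm_position[OF kin]
  proof eventually_elim
    case (elim \<omega>)
    have X: "X t \<omega> = x0 + \<sigma>1 * \<sigma>2 * (B t \<omega> - B 0 \<omega>) + \<sigma>1 * \<epsilon> powr H * (Y 0 \<omega> - Y t \<omega>)" if "t \<ge> 0" for t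
    proof -
      let ?V = "integral {0..t} (\<lambda>s. Y s \<omega>)"
      have "?V = \<epsilon> * (Y 0 \<omega> - Y t \<omega> + \<sigma>2 / \<epsilon> powr H * (B t \<omega> - B 0 \<omega>))"
        using elim that \<epsilon> by (simp add: field_simps)
      moreover have "X t \<omega> = x0 + \<sigma>1 * \<epsilon> powr (H - 1) * ?V"
        using elim that by simp
      ultimately have "X t \<omega> = x0 + \<sigma>1 * (\<epsilon> powr (H - 1) * \<epsilon>)
          * (Y 0 \<omega> - Y t \<omega> + \<sigma>2 / \<epsilon> powr H * (B t \<omega> - B 0 \<omega>))"
        by (simp only: mult.assoc)
      also have "\<dots> = x0 + \<sigma>1 * \<epsilon> powr H * (Y 0 \<omega> - Y t \<omega> + \<sigma>2 / \<epsilon> powr H * (B t \<omega> - B 0 \<omega>))"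
        using \<epsilon> by (simp add: powr_diff)
      also have "\<dots> = x0 + \<sigma>1 * \<sigma>2 * (B t \<omega> - B 0 \<omega>) + \<sigma>1 * \<epsilon> powr H * (Y 0 \<omega> - Y t \<omega>)"
        using \<epsilon> by (simp add: field_simps)
      finally show ?thesis .
    qed
    show ?case
    proof (intro allI impI)
      fix t s :: real assume "0 \<le> t" "0 \<le> s"
      then show "X t \<omega> - X s \<omega> = \<sigma>1 * \<sigma>2 * (B t \<omega> - B s \<omega>)
          + (- \<sigma>1 * \<epsilon> powr H) * (Y t \<omega> - Y s \<omega>)"
        unfolding X[OF \<open>0 \<le> t\<close>] X[OF \<open>0 \<le> s\<close>] by (simp add: algebra_simps)
    qed
  qed
qed

section \<open>Mean square error of the estimator\<close>

text \<open>Here \<open>c\<close> is a coercivity constant of the unit-step noise for the given \<open>n\<close>, so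
\<open>c * \<delta> powr (2 * H)\<close> bounds the eigenvalues of the covariance matrix from below, and \<open>\<kappa>\<^sup>2\<close> bounds the
second moment of the perturbation term. Choosing the weight of the cross term as \<open>\<eta> = sqrt \<kappa>\<close>
balances its two contributions, \<open>\<eta>\<^sup>2\<close> and \<open>\<kappa>\<^sup>2 / \<eta>\<^sup>2\<close>.\<close>

lemma estimator_mean_square_error:
  fixes X Y :: "real \<Rightarrow> 'a \<Rightarrow> real"
  assumes \<epsilon>: "\<epsilon> > 0" and \<delta>: "\<delta> > 0" and n: "n > 0" and c: "c > 0"
    and coer: "\<And>v. c * (\<Sum>i<n. (v i)\<^sup>2) \<le> (\<Sum>i<n. \<Sum>j<n. v i * v j * fgn_cov H (real i - real j))"
    and kin: "kinetic_fbm M H \<sigma>1 \<sigma>2 x0 \<epsilon> B X Y"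
  defines "\<kappa> \<equiv> (1 + 512 * \<sigma>1\<^sup>2 * \<sigma>2\<^sup>2) * \<epsilon> powr (2 * H) / (c * \<delta> powr (2 * H))"
    and "s \<equiv> \<sigma>1 * \<sigma>2"
  shows "square_integrable M (sigma2_estimator H \<delta> n X)"
    and "(\<integral>\<omega>. (sigma2_estimator H \<delta> n X \<omega> - s\<^sup>2)\<^sup>2 \<partial>M)
      \<le> 4 * (2 * s ^ 4 / real n + 4 * s\<^sup>2 * \<kappa> + \<kappa>\<^sup>2)"
proof -
  define lam where "lam = c * \<delta> powr (2 * H)"
  have lam: "lam > 0" using c \<delta> by (simp add: lam_def)
  have \<kappa>: "\<kappa> > 0" using c \<delta> \<epsilon> unfolding \<kappa>_def by (intro divide_pos_pos mult_pos_pos add_pos_nonneg) auto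
  obtain q where q: "coercive_inverse n (\<lambda>i j. \<delta> powr (2 * H) * fgn_cov H (real i - real j)) q lam"
    and est: "\<And>\<omega>. sigma2_estimator H \<delta> n X \<omega> =
       quad_form n q (\<lambda>i. X ((real i + 1) * \<delta>) \<omega> - X (real i * \<delta>) \<omega>)
         (\<lambda>i. X ((real i + 1) * \<delta>) \<omega> - X (real i * \<delta>) \<omega>) / real n"
    by (rule estimator_coercive_inverse[OF \<delta> c coer, where X = X, folded lam_def], rule that)
  interpret coercive_inverse n "\<lambda>i j. \<delta> powr (2 * H) * fgn_cov H (real i - real j)" q lam by (rule q)
  define b where "b i = (\<lambda>\<omega>. B ((real i + 1) * \<delta>) \<omega> - B (real i * \<delta>) \<omega>)" for i :: nat
  define r where "r i = (\<lambda>\<omega>. (- \<sigma>1 * \<epsilon> powr H) * (Y ((real i + 1) * \<delta>) \<omega> - Y (real i * \<delta>) \<omega>))" for i :: nat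
  define A where "A = (\<lambda>\<omega>. 1 / real n * (\<Sum>i<n. \<Sum>j<n. q i j * b i \<omega> * b j \<omega>))"
  \<comment> \<open>By Cauchy--Schwarz \<open>G\<close> dominates the square of the perturbation term, and its mean needs only fourth moments of single increments.\<close>
  define G where "G = (\<lambda>\<omega>. (\<Sum>i<n. r i \<omega> ^ 4) / (lam\<^sup>2 * real n))"
  define F where "F = sigma2_estimator H \<delta> n X"
  define R where "R = (\<lambda>\<omega>. 4 * (s ^ 4 * (A \<omega> - 1)\<^sup>2 + s\<^sup>2 * \<kappa> * (A \<omega>)\<^sup>2 + s\<^sup>2 / \<kappa> * G \<omega> + G \<omega>))"
  have b_span: "b i \<in> lin_span B" for i unfolding b_def by (rule increment_span)
  have b_cov: "(\<integral>\<omega>. b i \<omega> * b j \<omega> \<partial>M) = \<delta> powr (2 * H) * fgn_cov H (real i - real j)" for i j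
    unfolding b_def by (rule noise_covariance[OF \<delta>])
  have A: "integrable M (\<lambda>\<omega>. (A \<omega>)\<^sup>2)" "(\<integral>\<omega>. (A \<omega>)\<^sup>2 \<partial>M) = 1 + 2 / real n"
    "integrable M (\<lambda>\<omega>. (A \<omega> - 1)\<^sup>2)" "(\<integral>\<omega>. (A \<omega> - 1)\<^sup>2 \<partial>M) = 2 / real n"
    unfolding A_def by (rule normalised_quadratic_form[OF b_span b_cov qp q_sym n]; assumption)+
  have r_L4: "L4 M (r i)" and r_moment: "(\<integral>\<omega>. r i \<omega> ^ 4 \<partial>M) \<le> (lam * \<kappa>)\<^sup>2" for i
  proof -
    have nn: "0 \<le> (real i + 1) * \<delta>" "0 \<le> real i * \<delta>" using \<delta> by auto
    show "L4 M (r i)" unfolding r_def by (intro L4_scale increment_fourth_moment[OF \<epsilon> kin] nn)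
    have "(\<integral>\<omega>. r i \<omega> ^ 4 \<partial>M) = (- \<sigma>1 * \<epsilon> powr H) ^ 4 *
        (\<integral>\<omega>. (Y ((real i + 1) * \<delta>) \<omega> - Y (real i * \<delta>) \<omega>) ^ 4 \<partial>M)"
      unfolding r_def power_mult_distrib[of "- \<sigma>1 * \<epsilon> powr H"] by simp
    also have "\<dots> \<le> (- \<sigma>1 * \<epsilon> powr H) ^ 4 * (512\<^sup>2 * \<sigma>2 ^ 4)"
      by (intro mult_left_mono increment_fourth_moment[OF \<epsilon> kin] nn) auto
    also have "\<dots> = (512 * \<sigma>1\<^sup>2 * \<sigma>2\<^sup>2 * (\<epsilon> powr H)\<^sup>2)\<^sup>2"
      by (simp add: power_mult_distrib flip: power_mult)
    also have "(\<epsilon> powr H)\<^sup>2 = \<epsilon> powr (2 * H)" using \<epsilon> by (simp add: powr_power mult.commute)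
    also have "(512 * \<sigma>1\<^sup>2 * \<sigma>2\<^sup>2 * \<epsilon> powr (2 * H))\<^sup>2 \<le> ((1 + 512 * \<sigma>1\<^sup>2 * \<sigma>2\<^sup>2) * \<epsilon> powr (2 * H))\<^sup>2"
      by (intro power_mono mult_right_mono) auto
    also have "(1 + 512 * \<sigma>1\<^sup>2 * \<sigma>2\<^sup>2) * \<epsilon> powr (2 * H) = lam * \<kappa>"
      using lam unfolding \<kappa>_def lam_def[symmetric] by simp
    finally show "(\<integral>\<omega>. r i \<omega> ^ 4 \<partial>M) \<le> (lam * \<kappa>)\<^sup>2" .
  qed
  have r4: "integrable M (\<lambda>\<omega>. r i \<omega> ^ 4)" for i using r_L4 by (simp add: L4_def)
  have G_int: "integrable M G" unfolding G_def using r4 by simp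
  have G_le: "(\<integral>\<omega>. G \<omega> \<partial>M) \<le> \<kappa>\<^sup>2"
  proof -
    have "(\<integral>\<omega>. G \<omega> \<partial>M) = (\<Sum>i<n. \<integral>\<omega>. r i \<omega> ^ 4 \<partial>M) / (lam\<^sup>2 * real n)"
      unfolding G_def using r4 by simp
    also have "\<dots> \<le> (\<Sum>i<n. (lam * \<kappa>)\<^sup>2) / (lam\<^sup>2 * real n)"
      using r_moment by (intro divide_right_mono sum_mono) auto
    also have "\<dots> = \<kappa>\<^sup>2" using lam n by (simp add: power_mult_distrib)
    finally show ?thesis .
  qed
  have R_int: "integrable M R"
    unfolding R_def using A(1,3) G_int by (intro integrable_mult_right Bochner_Integration.integrable_add) auto
  have F_meas [measurable]: "F \<in> borel_measurable M"
  proof -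
    have [measurable]: "X ((real i + 1) * \<delta>) \<in> borel_measurable M" "X (real i * \<delta>) \<in> borel_measurable M" for i :: nat
      using \<delta> by (intro kinetic_fbm_measurable[OF kin]; simp)+
    show ?thesis unfolding F_def est[abs_def] quad_form_def by measurable
  qed
  have "AE \<omega> in M. (F \<omega> - s\<^sup>2)\<^sup>2 \<le> R \<omega>"
    using position_increment[OF \<epsilon> kin]
  proof eventually_elim
    case (elim \<omega>)
    have "X ((real i + 1) * \<delta>) \<omega> - X (real i * \<delta>) \<omega> = s * b i \<omega> + r i \<omega>" for i :: nat
      using elim[rule_format, of "(real i + 1) * \<delta>" "real i * \<delta>"] \<delta> by (simp add: b_def r_def s_def)
    then have F: "F \<omega> = quad_form n q (\<lambda>i. s * b i \<omega> + r i \<omega>) (\<lambda>i. s * b i \<omega> + r i \<omega>) / real n"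
      unfolding F_def est by simp
    have A': "A \<omega> = quad_form n q (\<lambda>i. b i \<omega>) (\<lambda>i. b i \<omega>) / real n"
      by (simp add: A_def quad_form_def)
    let ?D = "(\<Sum>i<n. (r i \<omega>)\<^sup>2) / (lam * real n)"
    have D: "?D\<^sup>2 \<le> G \<omega>"
    proof -
      have "(\<Sum>i<n. 1 * (r i \<omega>)\<^sup>2)\<^sup>2 \<le> (\<Sum>i<n. 1\<^sup>2) * (\<Sum>i<n. ((r i \<omega>)\<^sup>2)\<^sup>2)"
        by (rule Cauchy_Schwarz_ineq_sum)
      then have "(\<Sum>i<n. (r i \<omega>)\<^sup>2)\<^sup>2 \<le> real n * (\<Sum>i<n. r i \<omega> ^ 4)" by simp
      then have "?D\<^sup>2 \<le> real n * (\<Sum>i<n. r i \<omega> ^ 4) / (lam * real n)\<^sup>2"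
        unfolding power_divide by (rule divide_right_mono) simp
      also have "\<dots> = G \<omega>" using n lam by (simp add: G_def power2_eq_square)
      finally show ?thesis .
    qed
    have "(F \<omega> - s\<^sup>2)\<^sup>2 \<le> 4 * (s ^ 4 * (A \<omega> - 1)\<^sup>2 + s\<^sup>2 * (sqrt \<kappa>)\<^sup>2 * (A \<omega>)\<^sup>2
        + s\<^sup>2 * ?D\<^sup>2 / (sqrt \<kappa>)\<^sup>2 + ?D\<^sup>2)"
      unfolding F A' by (rule perturbed_quad_form_error) (use \<kappa> n in auto)
    also have "\<dots> = 4 * (s ^ 4 * (A \<omega> - 1)\<^sup>2 + s\<^sup>2 * \<kappa> * (A \<omega>)\<^sup>2 + s\<^sup>2 / \<kappa> * ?D\<^sup>2 + ?D\<^sup>2)"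
      using \<kappa> by simp
    also have "\<dots> \<le> R \<omega>"
      unfolding R_def using \<kappa> by (intro mult_left_mono add_mono order_refl D) auto
    finally show ?case .
  qed
  then have dom: "AE \<omega> in M. norm ((F \<omega> - s\<^sup>2)\<^sup>2) \<le> norm (R \<omega>)"
    by eventually_elim auto
  have err_int: "integrable M (\<lambda>\<omega>. (F \<omega> - s\<^sup>2)\<^sup>2)"
    by (rule Bochner_Integration.integrable_bound[OF R_int _ dom]) measurable
  have "integrable M (\<lambda>\<omega>. (F \<omega>)\<^sup>2)"
  proof (rule Bochner_Integration.integrable_bound)
    show "integrable M (\<lambda>\<omega>. 2 * (F \<omega> - s\<^sup>2)\<^sup>2 + 2 * s ^ 4)" using err_int by simp
    show "AE \<omega> in M. norm ((F \<omega>)\<^sup>2) \<le> norm (2 * (F \<omega> - s\<^sup>2)\<^sup>2 + 2 * s ^ 4)"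
    proof (rule AE_I2)
      fix \<omega>
      \<comment> \<open>\<open>x\<^sup>2 \<le> 2 * (x - a)\<^sup>2 + 2 * a\<^sup>2\<close> with \<open>a = s\<^sup>2\<close>.\<close>
      have "0 \<le> (F \<omega> - 2 * s\<^sup>2)\<^sup>2" by simp
      also have "\<dots> = 2 * (F \<omega> - s\<^sup>2)\<^sup>2 + 2 * s ^ 4 - (F \<omega>)\<^sup>2"
        by (simp add: power2_eq_square eval_nat_numeral algebra_simps)
      finally show "norm ((F \<omega>)\<^sup>2) \<le> norm (2 * (F \<omega> - s\<^sup>2)\<^sup>2 + 2 * s ^ 4)" by simp
    qed
  qed measurable
  then show "square_integrable M (sigma2_estimator H \<delta> n X)"
    using F_meas by (simp add: square_integrable_def F_def)
  have "(\<integral>\<omega>. (F \<omega> - s\<^sup>2)\<^sup>2 \<partial>M) \<le> (\<integral>\<omega>. R \<omega> \<partial>M)"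
    by (intro integral_mono_AE err_int R_int) fact
  also have "\<dots> = 4 * (s ^ 4 * (2 / real n) + s\<^sup>2 * \<kappa> * (1 + 2 / real n)
      + s\<^sup>2 / \<kappa> * (\<integral>\<omega>. G \<omega> \<partial>M) + (\<integral>\<omega>. G \<omega> \<partial>M))"
    unfolding R_def using A G_int by simp
  also have "\<dots> \<le> 4 * (s ^ 4 * (2 / real n) + s\<^sup>2 * \<kappa> * 3 + s\<^sup>2 / \<kappa> * \<kappa>\<^sup>2 + \<kappa>\<^sup>2)"
    using n \<kappa> by (intro mult_left_mono add_mono order_refl G_le) (auto simp: field_simps)
  also have "\<dots> = 4 * (2 * s ^ 4 / real n + 4 * s\<^sup>2 * \<kappa> + \<kappa>\<^sup>2)"
    using \<kappa> by (simp add: power2_eq_square)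
  finally show "(\<integral>\<omega>. (sigma2_estimator H \<delta> n X \<omega> - s\<^sup>2)\<^sup>2 \<partial>M)
      \<le> 4 * (2 * s ^ 4 / real n + 4 * s\<^sup>2 * \<kappa> + \<kappa>\<^sup>2)" by (simp add: F_def)
qed

end

section \<open>Convergence of the estimator\<close>

text \<open>For \<open>H \<le> 1/2\<close> the exponent is \<open>2 * H - \<alpha>\<close>, and \<open>1 - H \<ge> 1/2\<close> gives \<open>H / (1 - H) \<le> 2 * H\<close>; for larger
\<open>H\<close> it is \<open>2 * H * (1 - \<alpha>)\<close>.\<close>

lemma sampling_exponent_pos:
  fixes H \<alpha> :: real
  assumes "0 < H" "H < 1" "0 < \<alpha>" "\<alpha> < min 1 (H / (1 - H))"
  shows "0 < 2 * H - \<alpha> * (2 * H + max 0 (1 - 2 * H))"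
proof (cases "H \<le> 1/2")
  case True
  have "\<alpha> < H / (1 - H)" using assms by simp
  also have "\<dots> \<le> H / (1 / 2)" using assms True by (intro divide_left_mono) auto
  finally show ?thesis using True by simp
next
  case False
  then show ?thesis using assms by simp
qed

theorem theorem3p2:
  fixes M :: "'a measure"
    and H T \<alpha> \<sigma>1 \<sigma>2 x0 :: real
    and B :: "real \<Rightarrow> 'a \<Rightarrow> real"
    and X Y :: "real \<Rightarrow> real \<Rightarrow> 'a \<Rightarrow> real"
    and N :: "real \<Rightarrow> nat"
  assumes "prob_space M"
    and "0 < H" and "H < 1"
    and "T > 0"
    and "fractional_brownian_motion M H B"
    and "\<And>\<epsilon>. \<epsilon> > 0 \<Longrightarrow> kinetic_fbm M H \<sigma>1 \<sigma>2 x0 \<epsilon> B (X \<epsilon>) (Y \<epsilon>)"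
    and "0 < \<alpha>" and "\<alpha> < min 1 (H / (1 - H))"
    and "\<And>\<epsilon>. \<epsilon> \<in> admissible_scales T \<alpha> \<Longrightarrow> T = real (N \<epsilon>) * \<epsilon> powr \<alpha>"
  shows "tendsto_L2_within M
           (\<lambda>\<epsilon>. sigma2_estimator H (\<epsilon> powr \<alpha>) (N \<epsilon>) (X \<epsilon>)) (\<lambda>_. (\<sigma>1 * \<sigma>2)\<^sup>2)
           0 (admissible_scales T \<alpha>)"
proof -
  interpret prob_space M by (rule assms(1))
  interpret fractional_brownian M H B by unfold_locales (rule assms)+
  define p where "p = max 0 (1 - 2 * H)"
  define s where "s = \<sigma>1 * \<sigma>2"
  define \<beta> where "\<beta> = 2 * H - \<alpha> * (2 * H + p)"
  let ?S = "admissible_scales T \<alpha>"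
  obtain c where c: "c > 0" and coer: "\<And>n v. n > 0 \<Longrightarrow> c * real n powr (- p) * (\<Sum>i<n. (v i)\<^sup>2)
      \<le> (\<Sum>i<n. \<Sum>j<n. v i * v j * fgn_cov H (real i - real j))"
    by (rule fgn_cov_coercive[OF assms(2,3), folded p_def]) blast
  define K where "K = (1 + 512 * \<sigma>1\<^sup>2 * \<sigma>2\<^sup>2) * T powr p / c"
  define bound where "bound \<epsilon> = 4 * (2 * s ^ 4 * (\<epsilon> powr \<alpha> / T) + 4 * s\<^sup>2 * (K * \<epsilon> powr \<beta>) + (K * \<epsilon> powr \<beta>)\<^sup>2)"
    for \<epsilon>
  have \<beta>: "\<beta> > 0" unfolding \<beta>_def p_def by (rule sampling_exponent_pos[OF assms(2,3,7,8)])
  have error: "square_integrable M (sigma2_estimator H (\<epsilon> powr \<alpha>) (N \<epsilon>) (X \<epsilon>)) \<and>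
      (\<integral>\<omega>. (sigma2_estimator H (\<epsilon> powr \<alpha>) (N \<epsilon>) (X \<epsilon>) \<omega> - s\<^sup>2)\<^sup>2 \<partial>M) \<le> bound \<epsilon>" if "\<epsilon> \<in> ?S" for \<epsilon>
  proof -
    have \<epsilon>: "\<epsilon> > 0" using that by (simp add: admissible_scales_def)
    have T: "T = real (N \<epsilon>) * \<epsilon> powr \<alpha>" by (rule assms(9)[OF that])
    then have n: "N \<epsilon> > 0" using \<open>T > 0\<close> by (cases "N \<epsilon> = 0") auto
    have \<delta>: "\<epsilon> powr \<alpha> > 0" using \<epsilon> by simp
    have n_eq: "real (N \<epsilon>) = T / \<epsilon> powr \<alpha>" using \<delta> by (simp add: T field_simps)
    have cn: "c * real (N \<epsilon>) powr (- p) > 0" using c n by simp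
    have "(1 + 512 * \<sigma>1\<^sup>2 * \<sigma>2\<^sup>2) * \<epsilon> powr (2 * H) / (c * real (N \<epsilon>) powr (- p) * (\<epsilon> powr \<alpha>) powr (2 * H))
      = K * \<epsilon> powr \<beta>"
    proof -
      have e1: "real (N \<epsilon>) powr (- p) = T powr (- p) * \<epsilon> powr (\<alpha> * p)"
        unfolding n_eq using \<epsilon> \<open>T > 0\<close> by (simp add: powr_divide powr_powr powr_minus field_simps)
      have e2: "\<epsilon> powr \<beta> = \<epsilon> powr (2 * H) / (\<epsilon> powr (\<alpha> * p) * \<epsilon> powr (\<alpha> * (2 * H)))"
        unfolding \<beta>_def powr_add[symmetric] powr_diff by (simp add: algebra_simps)
      show ?thesis
        unfolding e1 e2 K_def powr_powr powr_minus_divide[of T] using \<epsilon> \<open>T > 0\<close> c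
        by (simp add: field_simps)
    qed
    moreover have "2 * s ^ 4 / real (N \<epsilon>) = 2 * s ^ 4 * (\<epsilon> powr \<alpha> / T)"
      unfolding n_eq using \<delta> \<open>T > 0\<close> by simp
    ultimately show ?thesis
      using estimator_mean_square_error[OF \<epsilon> \<delta> n cn coer[OF n] assms(6)[OF \<epsilon>]]
      unfolding bound_def s_def by simp
  qed
  have lim_powr: "((\<lambda>\<epsilon>. \<epsilon> powr e) \<longlongrightarrow> 0) (at 0 within ?S)" if "e > 0" for e :: real
  proof (rule tendsto_zero_powrI)
    show "\<forall>\<^sub>F \<epsilon> in at 0 within ?S. 0 \<le> \<epsilon>"
      by (auto simp: eventually_at_filter admissible_scales_def)
  qed (use that in \<open>auto intro!: tendsto_intros\<close>)
  have "(bound \<longlongrightarrow> 4 * (2 * s ^ 4 * (0 / T) + 4 * s\<^sup>2 * (K * 0) + (K * 0)\<^sup>2)) (at 0 within ?S)"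
    unfolding bound_def using \<open>T > 0\<close>
    by (intro tendsto_intros lim_powr \<beta> assms(7)) auto
  then have bound_lim: "(bound \<longlongrightarrow> 0) (at 0 within ?S)" by simp
  have "((\<lambda>\<epsilon>. \<integral>\<omega>. (sigma2_estimator H (\<epsilon> powr \<alpha>) (N \<epsilon>) (X \<epsilon>) \<omega> - s\<^sup>2)\<^sup>2 \<partial>M) \<longlongrightarrow> 0) (at 0 within ?S)"
  proof (rule tendsto_sandwich[OF _ _ tendsto_const bound_lim])
    show "\<forall>\<^sub>F \<epsilon> in at 0 within ?S. 0 \<le> (\<integral>\<omega>. (sigma2_estimator H (\<epsilon> powr \<alpha>) (N \<epsilon>) (X \<epsilon>) \<omega> - s\<^sup>2)\<^sup>2 \<partial>M)"
      by (intro always_eventually allI integral_nonneg_AE) auto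
    show "\<forall>\<^sub>F \<epsilon> in at 0 within ?S.
        (\<integral>\<omega>. (sigma2_estimator H (\<epsilon> powr \<alpha>) (N \<epsilon>) (X \<epsilon>) \<omega> - s\<^sup>2)\<^sup>2 \<partial>M) \<le> bound \<epsilon>"
      using error by (auto simp: eventually_at_filter)
  qed
  then show ?thesis
    using error unfolding tendsto_L2_within_def s_def by (simp add: square_integrable_def)
qed

end
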